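(* For every $n\ge 2$ and every $m\ge 0$ there is no quasi-isometric embedding $$\mathrm H^n\to T_1\times\dots\times T_{n-1}\times\mathbb R^m$$ of the real $n$-dimensional hyperbolic space $\mathrm H^n$ into the metric product of $n-1$ metric trees $T_1,\dots,T_{n-1}$ and the Euclidean space $\mathbb R^m$.
   Context: A map $f:X\to Y$ between metric spaces is quasi-isometric (a quasi-isometric embedding) if there are $\Lambda\ge1$, $\lambda\ge0$ with $\frac1\Lambda|x-x'|-\lambda\le|f(x)-f(x')|\le\Lambda|x-x'|+\lambda$ for all $x,x'\in X$. Products of metric spaces carry the $\ell^2$ product metric. A metric tree is a geodesic metric space in which any two points are joined by a unique arc. *)

theory Defs
  imports "HOL-Analysis.Analysis"
begin

section \<open>Products and Euclidean spaces\<close>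

text \<open>Finite \<open>\<ell>\<^sup>2\<close> products. The library's \<^const>\<open>prod_metric\<close> is the binary version. The
  factors share a type but not a carrier; since any set-indexed family of metric spaces has
  isometric copies inside one type, this is no restriction.\<close>

definition l2_product_metric :: "'i set \<Rightarrow> ('i \<Rightarrow> 'a metric) \<Rightarrow> ('i \<Rightarrow> 'a) metric" where
  "l2_product_metric I M =
     metric (\<Pi>\<^sub>E i\<in>I. mspace (M i), \<lambda>x y. L2_set (\<lambda>i. mdist (M i) (x i) (y i)) I)"

lemma Metric_space_l2_product:
  assumes "finite I"
  shows "Metric_space (\<Pi>\<^sub>E i\<in>I. mspace (M i)) (\<lambda>x y. L2_set (\<lambda>i. mdist (M i) (x i) (y i)) I)"
proof
  fix x y
  show "L2_set (\<lambda>i. mdist (M i) (x i) (y i)) I = L2_set (\<lambda>i. mdist (M i) (y i) (x i)) I"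
    by (simp add: mdist_commute)
next
  fix x y
  assume "x \<in> (\<Pi>\<^sub>E i\<in>I. mspace (M i))" "y \<in> (\<Pi>\<^sub>E i\<in>I. mspace (M i))"
  then show "L2_set (\<lambda>i. mdist (M i) (x i) (y i)) I = 0 \<longleftrightarrow> x = y"
    using assms by (auto simp: L2_set_eq_0_iff PiE_iff mdist_zero intro: extensionalityI)
next
  fix x y z
  assume "x \<in> (\<Pi>\<^sub>E i\<in>I. mspace (M i))" "y \<in> (\<Pi>\<^sub>E i\<in>I. mspace (M i))"
    "z \<in> (\<Pi>\<^sub>E i\<in>I. mspace (M i))"
  then have "L2_set (\<lambda>i. mdist (M i) (x i) (z i)) I
        \<le> L2_set (\<lambda>i. mdist (M i) (x i) (y i) + mdist (M i) (y i) (z i)) I"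
    by (intro L2_set_mono) (auto simp: PiE_iff intro: mdist_triangle)
  also have "\<dots> \<le> L2_set (\<lambda>i. mdist (M i) (x i) (y i)) I + L2_set (\<lambda>i. mdist (M i) (y i) (z i)) I"
    by (rule L2_set_triangle_ineq)
  finally show "L2_set (\<lambda>i. mdist (M i) (x i) (z i)) I
      \<le> L2_set (\<lambda>i. mdist (M i) (x i) (y i)) I + L2_set (\<lambda>i. mdist (M i) (y i) (z i)) I" .
qed simp

lemma mspace_l2_product [simp]:
  "finite I \<Longrightarrow> mspace (l2_product_metric I M) = (\<Pi>\<^sub>E i\<in>I. mspace (M i))"
  by (simp add: l2_product_metric_def Metric_space.mspace_metric[OF Metric_space_l2_product])

lemma mdist_l2_product [simp]:
  "finite I \<Longrightarrow> mdist (l2_product_metric I M) = (\<lambda>x y. L2_set (\<lambda>i. mdist (M i) (x i) (y i)) I)"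
  by (simp add: l2_product_metric_def Metric_space.mdist_metric[OF Metric_space_l2_product])

text \<open>\<open>\<real>\<^sup>m\<close> with its Euclidean metric; coordinates are numbered from 1, and \<open>\<real>\<^sup>0\<close> is a point.\<close>

definition Euclidean_metric :: "nat \<Rightarrow> (nat \<Rightarrow> real) metric" where
  "Euclidean_metric m = l2_product_metric {1..m} (\<lambda>_. euclidean_metric)"

lemma mspace_Euclidean [simp]: "mspace (Euclidean_metric m) = (\<Pi>\<^sub>E i\<in>{1..m}. UNIV)"
  by (simp add: Euclidean_metric_def)

lemma mdist_Euclidean [simp]: "mdist (Euclidean_metric m) x y = L2_set (\<lambda>i. x i - y i) {1..m}"
  by (simp add: Euclidean_metric_def L2_set_def dist_real_def)


section \<open>Hyperbolic space\<close>

text \<open>The upper half-space model \<open>{x \<in> \<real>\<^sup>n. x\<^sub>n > 0}\<close>, \<open>n \<ge> 1\<close>, with the distance of the Riemannian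
  metric \<open>(dx\<^sub>1\<^sup>2 + \<dots> + dx\<^sub>n\<^sup>2) / x\<^sub>n\<^sup>2\<close> of curvature \<open>-1\<close>, given by its closed form
  \<open>cosh d(x, y) = 1 + |x - y|\<^sup>2 / (2 x\<^sub>n y\<^sub>n)\<close>. The value 0 off the carrier is there because
  \<^locale>\<open>Metric_space\<close> wants a distance that is nonnegative and symmetric everywhere.\<close>

definition hyperbolic_carrier :: "nat \<Rightarrow> (nat \<Rightarrow> real) set" where
  "hyperbolic_carrier n = {x \<in> mspace (Euclidean_metric n). x n > 0}"

definition hyperbolic_dist :: "nat \<Rightarrow> (nat \<Rightarrow> real) \<Rightarrow> (nat \<Rightarrow> real) \<Rightarrow> real" where
  "hyperbolic_dist n x y =
     (if x \<in> hyperbolic_carrier n \<and> y \<in> hyperbolic_carrier n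
      then arcosh (1 + (mdist (Euclidean_metric n) x y)\<^sup>2 / (2 * x n * y n)) else 0)"

definition hyperbolic_metric :: "nat \<Rightarrow> (nat \<Rightarrow> real) metric" where
  "hyperbolic_metric n = metric (hyperbolic_carrier n, hyperbolic_dist n)"

text \<open>The triangle inequality is Ptolemy's inequality for \<open>x, y, z\<close> and the mirror image of \<open>y\<close> in
  the boundary hyperplane.\<close>

lemma L2_set_inversion:
  fixes a b :: "'i \<Rightarrow> real"
  assumes "L2_set a I \<noteq> 0" "L2_set b I \<noteq> 0"
  shows "L2_set (\<lambda>i. a i / (L2_set a I)\<^sup>2 - b i / (L2_set b I)\<^sup>2) I
       = L2_set (\<lambda>i. a i - b i) I / (L2_set a I * L2_set b I)"
proof -
  define A B where AB: "A = L2_set a I" "B = L2_set b I"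
  have nz: "A > 0" "B > 0"
    using assms L2_set_nonneg[of a I] L2_set_nonneg[of b I] unfolding AB by linarith+
  have A2: "(\<Sum>i\<in>I. (a i)\<^sup>2) = A\<^sup>2" and B2: "(\<Sum>i\<in>I. (b i)\<^sup>2) = B\<^sup>2"
    unfolding AB L2_set_def by (simp_all add: sum_nonneg)
  define P where "P = (\<Sum>i\<in>I. a i * b i)"
  have "(\<Sum>i\<in>I. (a i / A\<^sup>2 - b i / B\<^sup>2)\<^sup>2)
      = (\<Sum>i\<in>I. (a i)\<^sup>2 / A^4 + (b i)\<^sup>2 / B^4 - 2 * (a i * b i) / (A\<^sup>2 * B\<^sup>2))"
    by (rule sum.cong) (simp_all add: power2_diff power_divide)
  also have "\<dots> = A\<^sup>2 / A^4 + B\<^sup>2 / B^4 - 2 * P / (A\<^sup>2 * B\<^sup>2)"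
    unfolding sum_subtractf sum.distrib P_def
    by (simp add: A2 B2 flip: sum_divide_distrib sum_distrib_left)
  also have "\<dots> = (A\<^sup>2 + B\<^sup>2 - 2 * P) / (A * B)\<^sup>2"
    using nz by (simp add: field_simps power2_eq_square power4_eq_xxxx)
  also have "A\<^sup>2 + B\<^sup>2 - 2 * P = (\<Sum>i\<in>I. (a i - b i)\<^sup>2)"
    unfolding A2[symmetric] B2[symmetric] P_def power2_diff sum_subtractf sum.distrib
    by (simp add: sum_distrib_left mult.assoc)
  finally have "sqrt (\<Sum>i\<in>I. (a i / A\<^sup>2 - b i / B\<^sup>2)\<^sup>2) = sqrt (\<Sum>i\<in>I. (a i - b i)\<^sup>2) / (A * B)"
    using nz by (simp add: real_sqrt_divide)
  then show ?thesis
    unfolding AB by (simp add: L2_set_def)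
qed

lemma L2_set_Ptolemy:
  fixes a b c :: "'i \<Rightarrow> real"
  assumes "finite I"
  defines "N \<equiv> \<lambda>f :: 'i \<Rightarrow> real. L2_set f I"
  shows "N (\<lambda>i. a i - c i) * N b \<le> N (\<lambda>i. a i - b i) * N c + N (\<lambda>i. b i - c i) * N a"
proof -
  have nn: "N f \<ge> 0" for f
    by (simp add: N_def)
  have z: "f i = 0" if "N f = 0" "i \<in> I" for f i
    using that assms by (auto simp: L2_set_eq_0_iff)
  have m: "N (\<lambda>i. - f i) = N f" for f
    by (simp add: N_def L2_set_def)
  consider "N a = 0" | "N b = 0" | "N c = 0" | "N a \<noteq> 0" "N b \<noteq> 0" "N c \<noteq> 0"
    by blast
  then show ?thesis
  proof cases
    case 1
    have "N (\<lambda>i. a i - c i) = N (\<lambda>i. - c i)" "N (\<lambda>i. a i - b i) = N (\<lambda>i. - b i)"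
      using z[OF 1] unfolding N_def by (auto intro!: L2_set_cong)
    then show ?thesis
      using 1 m by (simp add: mult.commute)
  next
    case 2
    then show ?thesis
      using nn by simp
  next
    case 3
    have "N (\<lambda>i. a i - c i) = N a" "N (\<lambda>i. b i - c i) = N b"
      using z[OF 3] unfolding N_def by (auto intro!: L2_set_cong)
    then show ?thesis
      using 3 by (simp add: mult.commute)
  next
    case 4
    have pos: "N a > 0" "N b > 0" "N c > 0"
      using 4 nn by (simp_all add: less_le)
    let ?v = "\<lambda>f i. f i / (N f)\<^sup>2"
    have "N (\<lambda>i. (?v a i - ?v b i) + (?v b i - ?v c i))
        \<le> N (\<lambda>i. ?v a i - ?v b i) + N (\<lambda>i. ?v b i - ?v c i)"
      unfolding N_def by (rule L2_set_triangle_ineq)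
    then have "N (\<lambda>i. ?v a i - ?v c i) \<le> N (\<lambda>i. ?v a i - ?v b i) + N (\<lambda>i. ?v b i - ?v c i)"
      by simp
    then have "N (\<lambda>i. a i - c i) / (N a * N c)
        \<le> N (\<lambda>i. a i - b i) / (N a * N b) + N (\<lambda>i. b i - c i) / (N b * N c)"
      using 4 L2_set_inversion[of _ I] unfolding N_def by simp
    then have "N (\<lambda>i. a i - c i) / (N a * N c) * (N a * N b * N c)
        \<le> (N (\<lambda>i. a i - b i) / (N a * N b) + N (\<lambda>i. b i - c i) / (N b * N c)) * (N a * N b * N c)"
      using pos by (intro mult_right_mono) auto
    moreover have "N (\<lambda>i. a i - c i) / (N a * N c) * (N a * N b * N c) = N (\<lambda>i. a i - c i) * N b"
      using pos by simp
    moreover have "(N (\<lambda>i. a i - b i) / (N a * N b) + N (\<lambda>i. b i - c i) / (N b * N c)) * (N a * N b * N c)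
        = N (\<lambda>i. a i - b i) * N c + N (\<lambda>i. b i - c i) * N a"
      using pos by (simp add: distrib_right)
    ultimately show ?thesis
      by simp
  qed
qed

lemma hyperbolic_arg_ge_1:
  assumes "x \<in> hyperbolic_carrier n" "y \<in> hyperbolic_carrier n"
  shows "1 \<le> 1 + (mdist (Euclidean_metric n) x y)\<^sup>2 / (2 * x n * y n)"
  using assms by (simp add: hyperbolic_carrier_def)

lemma hyperbolic_dist_nonneg: "0 \<le> hyperbolic_dist n x y"
  unfolding hyperbolic_dist_def using hyperbolic_arg_ge_1[of x n y] by (auto intro: arcosh_nonneg_real)

lemma cosh_hyperbolic_dist:
  assumes "x \<in> hyperbolic_carrier n" "y \<in> hyperbolic_carrier n"
  shows "cosh (hyperbolic_dist n x y) = 1 + (mdist (Euclidean_metric n) x y)\<^sup>2 / (2 * x n * y n)"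
  using cosh_arcosh_real[OF hyperbolic_arg_ge_1[OF assms]] assms by (simp add: hyperbolic_dist_def)

lemma hyperbolic_half_dist:
  assumes "x \<in> hyperbolic_carrier n" "y \<in> hyperbolic_carrier n" and n: "n \<ge> 1"
  defines "y' \<equiv> y(n := - y n)"
  shows "sinh (hyperbolic_dist n x y / 2) =
      L2_set (\<lambda>i. x i - y i) {1..n} / (2 * sqrt (x n) * sqrt (y n))"
    and "cosh (hyperbolic_dist n x y / 2) =
      L2_set (\<lambda>i. x i - y' i) {1..n} / (2 * sqrt (x n) * sqrt (y n))"
proof -
  define h where "h = hyperbolic_dist n x y / 2"
  define D where "D = L2_set (\<lambda>i. x i - y i) {1..n}"
  define D' where "D' = L2_set (\<lambda>i. x i - y' i) {1..n}"
  have pos: "x n > 0" "y n > 0"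
    using assms by (simp_all add: hyperbolic_carrier_def)
  have h: "h \<ge> 0"
    using hyperbolic_dist_nonneg by (simp add: h_def)
  have DD: "D \<ge> 0" "D' \<ge> 0"
    by (simp_all add: D_def D'_def)
  have split: "{1..n} = insert n {1..<n}"
    using n by auto
  have "D'\<^sup>2 = (\<Sum>i=1..n. (x i - y' i)\<^sup>2)" "D\<^sup>2 = (\<Sum>i=1..n. (x i - y i)\<^sup>2)"
    by (simp_all add: D_def D'_def L2_set_def sum_nonneg)
  moreover have "(\<Sum>i\<in>{1..<n}. (x i - y' i)\<^sup>2) = (\<Sum>i\<in>{1..<n}. (x i - y i)\<^sup>2)"
    by (rule sum.cong) (auto simp: y'_def)
  ultimately have D': "D'\<^sup>2 = D\<^sup>2 + 4 * x n * y n"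
    unfolding split by (simp add: y'_def power2_eq_square algebra_simps)
  have "cosh (2 * h) = 1 + D\<^sup>2 / (2 * x n * y n)"
    using cosh_hyperbolic_dist[OF assms(1,2)] by (simp add: h_def D_def)
  then have s: "(sinh h)\<^sup>2 = D\<^sup>2 / (4 * x n * y n)"
    by (simp add: cosh_double cosh_square_eq)
  then have c: "(cosh h)\<^sup>2 = D'\<^sup>2 / (4 * x n * y n)"
    using pos D' by (simp add: cosh_square_eq field_simps)
  have den: "(2 * sqrt (x n) * sqrt (y n))\<^sup>2 = 4 * x n * y n"
    using pos by (simp add: power_mult_distrib)
  have "sinh h = D / (2 * sqrt (x n) * sqrt (y n))"
    by (rule power2_eq_imp_eq) (use s den h DD pos in \<open>simp_all add: power_divide\<close>)
  moreover have "cosh h = D' / (2 * sqrt (x n) * sqrt (y n))"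
    by (rule power2_eq_imp_eq) (use c den h DD pos in \<open>simp_all add: power_divide\<close>)
  ultimately show "sinh (hyperbolic_dist n x y / 2) =
      L2_set (\<lambda>i. x i - y i) {1..n} / (2 * sqrt (x n) * sqrt (y n))"
    and "cosh (hyperbolic_dist n x y / 2) =
      L2_set (\<lambda>i. x i - y' i) {1..n} / (2 * sqrt (x n) * sqrt (y n))"
    by (simp_all add: h_def D_def D'_def)
qed

lemma hyperbolic_dist_commute: "hyperbolic_dist n x y = hyperbolic_dist n y x"
proof -
  have "L2_set (\<lambda>i. x i - y i) {1..n} = L2_set (\<lambda>i. y i - x i) {1..n}"
    by (simp add: L2_set_def power2_commute)
  then show ?thesis
    by (simp add: hyperbolic_dist_def mult.commute mult.left_commute)
qed

lemma hyperbolic_dist_eq_0_iff: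
  assumes "x \<in> hyperbolic_carrier n" "y \<in> hyperbolic_carrier n"
  shows "hyperbolic_dist n x y = 0 \<longleftrightarrow> x = y"
proof -
  have "hyperbolic_dist n x y = 0 \<longleftrightarrow> mdist (Euclidean_metric n) x y = 0"
    using arcosh_eq_0_iff_real[OF hyperbolic_arg_ge_1[OF assms]] assms
    by (simp add: hyperbolic_dist_def hyperbolic_carrier_def)
  also have "\<dots> \<longleftrightarrow> x = y"
    using assms by (intro mdist_zero) (auto simp: hyperbolic_carrier_def)
  finally show ?thesis .
qed

lemma hyperbolic_dist_triangle:
  assumes x: "x \<in> hyperbolic_carrier n" and y: "y \<in> hyperbolic_carrier n"
    and z: "z \<in> hyperbolic_carrier n" and n: "n \<ge> 1"
  shows "hyperbolic_dist n x z \<le> hyperbolic_dist n x y + hyperbolic_dist n y z"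
proof -
  define y' where "y' = y(n := - y n)"
  define N where "N = (\<lambda>f :: nat \<Rightarrow> real. L2_set f {1..n})"
  define A where "A = hyperbolic_dist n x y / 2"
  define B where "B = hyperbolic_dist n z y / 2"
  define r s t where rst: "r = sqrt (x n)" "s = sqrt (y n)" "t = sqrt (z n)"
  have pos: "r > 0" "s > 0" "t > 0" and s2: "s\<^sup>2 = y n"
    using x y z by (simp_all add: hyperbolic_carrier_def rst)
  have neg: "N (\<lambda>i. f i - g i) = N (\<lambda>i. g i - f i)" for f g
    by (simp add: N_def L2_set_def power2_commute)
  have split: "{1..n} = insert n {1..<n}"
    using n by auto
  have "N (\<lambda>i. y' i - y i) = 2 * y n"
  proof -
    have "(\<Sum>i\<in>{1..<n}. (y' i - y i)\<^sup>2) = 0"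
      by (rule sum.neutral) (simp add: y'_def)
    moreover have "(y' n - y n)\<^sup>2 = (2 * y n)\<^sup>2"
      by (simp add: y'_def power2_eq_square)
    ultimately show ?thesis
      using s2 y unfolding N_def L2_set_def split by (simp add: hyperbolic_carrier_def real_sqrt_mult)
  qed
  moreover have "N (\<lambda>i. (x i - y i) - (z i - y i)) * N (\<lambda>i. y' i - y i)
     \<le> N (\<lambda>i. (x i - y i) - (y' i - y i)) * N (\<lambda>i. z i - y i)
       + N (\<lambda>i. (y' i - y i) - (z i - y i)) * N (\<lambda>i. x i - y i)"
    unfolding N_def by (rule L2_set_Ptolemy) simp
  ultimately have P: "N (\<lambda>i. x i - z i) * (2 * s\<^sup>2)
     \<le> N (\<lambda>i. x i - y' i) * N (\<lambda>i. z i - y i) + N (\<lambda>i. z i - y' i) * N (\<lambda>i. x i - y i)"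
    using neg[of y' z] s2 by simp
  have "sinh (hyperbolic_dist n x z / 2) = N (\<lambda>i. x i - z i) / (2 * r * t)"
    using hyperbolic_half_dist(1)[OF x z n] by (simp add: N_def rst)
  also have "\<dots> = N (\<lambda>i. x i - z i) * (2 * s\<^sup>2) / (4 * r * s\<^sup>2 * t)"
    using pos by (simp add: field_simps)
  also have "\<dots> \<le> (N (\<lambda>i. x i - y' i) * N (\<lambda>i. z i - y i) + N (\<lambda>i. z i - y' i) * N (\<lambda>i. x i - y i))
      / (4 * r * s\<^sup>2 * t)"
    using P pos by (intro divide_right_mono) auto
  also have "\<dots> = N (\<lambda>i. x i - y i) / (2 * r * s) * (N (\<lambda>i. z i - y' i) / (2 * t * s))
      + N (\<lambda>i. x i - y' i) / (2 * r * s) * (N (\<lambda>i. z i - y i) / (2 * t * s))"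
    using pos by (simp add: field_simps power2_eq_square)
  also have "\<dots> = sinh A * cosh B + cosh A * sinh B"
    unfolding A_def B_def hyperbolic_half_dist[OF x y n] hyperbolic_half_dist[OF z y n]
    by (simp add: N_def rst y'_def)
  also have "\<dots> = sinh (A + B)"
    by (simp add: sinh_add)
  finally have "hyperbolic_dist n x z / 2 \<le> A + B"
    by simp
  then show ?thesis
    by (simp add: A_def B_def hyperbolic_dist_commute[of n z y])
qed

lemma Metric_space_hyperbolic:
  assumes "n \<ge> 1"
  shows "Metric_space (hyperbolic_carrier n) (hyperbolic_dist n)"
  using hyperbolic_dist_nonneg hyperbolic_dist_commute hyperbolic_dist_eq_0_iff
    hyperbolic_dist_triangle[OF _ _ _ assms]
  by (intro Metric_space.intro) auto

lemma mspace_hyperbolic [simp]: "n \<ge> 1 \<Longrightarrow> mspace (hyperbolic_metric n) = hyperbolic_carrier n"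
  by (simp add: hyperbolic_metric_def Metric_space.mspace_metric[OF Metric_space_hyperbolic])

lemma mdist_hyperbolic [simp]: "n \<ge> 1 \<Longrightarrow> mdist (hyperbolic_metric n) = hyperbolic_dist n"
  by (simp add: hyperbolic_metric_def Metric_space.mdist_metric[OF Metric_space_hyperbolic])


section \<open>Metric trees\<close>

definition geodesic_metric :: "'a metric \<Rightarrow> bool" where
  "geodesic_metric X \<longleftrightarrow>
     (\<forall>x\<in>mspace X. \<forall>y\<in>mspace X. \<exists>g :: real \<Rightarrow> 'a.
        g \<in> {0..mdist X x y} \<rightarrow> mspace X \<and> g 0 = x \<and> g (mdist X x y) = y \<and>
        (\<forall>s\<in>{0..mdist X x y}. \<forall>t\<in>{0..mdist X x y}. mdist X (g s) (g t) = \<bar>s - t\<bar>))"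

text \<open>Arcs are taken as point sets, i.e. up to reparametrization; in a metric space an injective
  path is a homeomorphism onto its image.\<close>

definition arc_between :: "'a topology \<Rightarrow> 'a \<Rightarrow> 'a \<Rightarrow> 'a set \<Rightarrow> bool" where
  "arc_between X x y A \<longleftrightarrow>
     (\<exists>g. pathin X g \<and> inj_on g {0..1} \<and> g 0 = x \<and> g 1 = y \<and> A = g ` {0..1})"

definition metric_tree :: "'a metric \<Rightarrow> bool" where
  "metric_tree X \<longleftrightarrow> geodesic_metric X \<and>
     (\<forall>x\<in>mspace X. \<forall>y\<in>mspace X. x \<noteq> y \<longrightarrow> (\<exists>!A. arc_between (mtopology_of X) x y A))"


section \<open>Quasi-isometric embeddings\<close>

definition quasi_isometric_embedding :: "'a metric \<Rightarrow> 'b metric \<Rightarrow> ('a \<Rightarrow> 'b) \<Rightarrow> bool" where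
  "quasi_isometric_embedding X Y f \<longleftrightarrow> f \<in> mspace X \<rightarrow> mspace Y \<and>
     (\<exists>L l. L \<ge> 1 \<and> l \<ge> 0 \<and> (\<forall>x\<in>mspace X. \<forall>x'\<in>mspace X.
        1 / L * mdist X x x' - l \<le> mdist Y (f x) (f x') \<and>
        mdist Y (f x) (f x') \<le> L * mdist X x x' + l))"

end

theory Submission
  imports Defs
begin

text \<open>Let \<open>F\<close> be the tree part of a quasi-isometric embedding of \<open>H\<^sup>n\<close>. A set on which \<open>F\<close> is bounded
  embeds quasi-isometrically into \<open>\<real>\<^sup>m\<close>, so it has polynomial growth, and horizontal distances
  shrink exponentially with depth. Look at a point \<open>o'\<close> and a large scale \<open>s\<close>.

  At a depth proportional to \<open>s\<close>, the points whose image stays within \<open>s\<close> of \<open>F o'\<close> are covered by a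
  number of balls of radius proportional to \<open>s\<close> that does not depend on \<open>s\<close>. Hence a whole unit cube
  (horizontal size 1 in the half-space model) below \<open>o'\<close> avoids them. Over this cube, between a
  depth that is a small multiple of \<open>s\<close> and the bottom, erect an \<open>n\<close>-dimensional box. The product of
  \<open>n - 1\<close> trees is the union of \<open>n\<close> families of uniformly bounded, mutually distant sets; pulled
  back, they colour the box with \<open>n\<close> colours. By the Hex theorem a monochromatic chain joins two
  opposite faces. It cannot go from top to bottom, where \<open>F\<close> is close to and far from \<open>F o'\<close>
  respectively, since \<open>F\<close> varies by a bounded amount on it. It cannot join two vertical faces either,
  since it would contain exponentially many in \<open>s\<close> separated points.\<close>

section \<open>Hex\<close>

text \<open>A coarse form of Gale's \<open>n\<close>-dimensional Hex theorem. Steps of length 2 are allowed so that the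
  cube found by Kuhn's lemma can be handled at any of its vertices.\<close>

lemma hex_chain:
  fixes c :: "(nat \<Rightarrow> nat) \<Rightarrow> nat" and n p :: nat
  assumes p: "0 < p" and c: "\<And>x. (\<And>j. j < n \<Longrightarrow> x j \<le> p) \<Longrightarrow> c x < n"
  defines "R \<equiv> \<lambda>i x y. (\<forall>j<n. x j \<le> p \<and> y j \<le> p \<and> x j \<le> y j + 2 \<and> y j \<le> x j + 2) \<and>
    c x = i \<and> c y = i"
  shows "\<exists>i<n. \<exists>x y. (\<forall>j<n. x j \<le> p) \<and> c x = i \<and> x i \<le> 1 \<and> p \<le> y i + 1 \<and> (R i)\<^sup>*\<^sup>* x y"
proof (rule ccontr)
  assume neg: "\<not> ?thesis"
  define Z where
    "Z = (\<lambda>i. {y. \<exists>x. (\<forall>j<n. x j \<le> p) \<and> c x = i \<and> x i \<le> 1 \<and> (R i)\<^sup>*\<^sup>* x y})"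
  define near where "near = (\<lambda>x y :: nat \<Rightarrow> nat. \<forall>j<n. x j \<le> y j + 1 \<and> y j \<le> x j + 1)"
  \<comment> \<open>Kuhn's lemma needs label 0 on the face \<open>x i = 0\<close> and label 1 on the
    face \<open>x i = p\<close>. The latter is where the absence of a crossing chain enters: a point
    within 1 of \<open>Z i\<close> is never on the upper face.\<close>
  define label where
    "label = (\<lambda>x i. if x i = 0 \<or> (\<exists>y\<in>Z i. near x y) then 0 else (1::nat))"
  have Z: "(\<forall>j<n. y j \<le> p) \<and> c y = i" if "y \<in> Z i" for y i
  proof -
    from that obtain x where "(\<forall>j<n. x j \<le> p) \<and> c x = i" "(R i)\<^sup>*\<^sup>* x y"
      unfolding Z_def by blast
    from this(2,1) show ?thesis
      by (induction rule: rtranclp_induct) (simp_all add: R_def)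
  qed
  have top: "label x i = 1" if "i < n" "x i = p" for x i
  proof -
    have False if "y \<in> Z i" "near x y" for y
    proof -
      have "p \<le> y i + 1"
        using that(2) \<open>i < n\<close> \<open>x i = p\<close> unfolding near_def by blast
      with that(1) neg \<open>i < n\<close> show False
        unfolding Z_def by blast
    qed
    then show ?thesis
      using that p unfolding label_def by auto
  qed
  obtain q where q: "\<forall>i<n. q i < p" and
    q': "\<forall>i<n. \<exists>r s. (\<forall>j<n. q j \<le> r j \<and> r j \<le> q j + 1) \<and> (\<forall>j<n. q j \<le> s j \<and> s j \<le> q j + 1) \<and>
      label r i \<noteq> label s i"
    by (rule kuhn_lemma[OF p, of n label]) (use top in \<open>auto simp: label_def\<close>)
  \<comment> \<open>The contradiction is found in the colour of the lowest vertex \<open>q\<close>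
    of Kuhn's cube. A vertex \<open>r\<close> with label 0 forces \<open>q\<close> into
    \<open>Z i\<close>; every vertex is within 1 of \<open>q\<close>, so \<open>s\<close> has label
    0 as well.\<close>
  define i where "i = c q"
  have "i < n"
    using c[of q] q by (auto simp: i_def less_imp_le)
  then obtain r s where rs: "\<forall>j<n. q j \<le> r j \<and> r j \<le> q j + 1" "\<forall>j<n. q j \<le> s j \<and> s j \<le> q j + 1"
    and l: "label r i = 0" "label s i \<noteq> 0"
    using q' by (metis (no_types, lifting) label_def)
  have "q \<in> Z i"
  proof (cases "r i = 0")
    case True
    then have "q i = 0"
      using rs \<open>i < n\<close> by force
    then show ?thesis
      unfolding Z_def i_def using q by (auto intro!: exI[of _ q] simp: less_imp_le)
  next
    case False
    then obtain y where y: "y \<in> Z i" "near r y"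
      using l by (auto simp: label_def split: if_splits)
    have "R i y q"
      unfolding R_def
    proof (intro conjI allI impI)
      fix j assume "j < n"
      with y(2) rs(1) have "r j \<le> y j + 1" "y j \<le> r j + 1" "q j \<le> r j" "r j \<le> q j + 1"
        by (auto simp: near_def)
      then show "y j \<le> q j + 2" "q j \<le> y j + 2"
        by linarith+
    qed (use Z[OF y(1)] q in \<open>auto simp: i_def less_imp_le\<close>)
    with y(1) show ?thesis
      unfolding Z_def by (auto intro: rtranclp.rtrancl_into_rtrancl)
  qed
  moreover have "near s q"
    using rs(2) unfolding near_def by (simp add: le_SucI)
  ultimately have "\<exists>y\<in>Z i. near s y"
    by blast
  then show False
    using l(2) by (simp add: label_def)
qed

section \<open>Colouring products of metric trees\<close>

text \<open>Rescaling to the unit interval gives a Lipschitz, hence continuous, path. Asking only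
  for an upper bound on distances lets the lemma cover a concatenation of two geodesic pieces before
  this is known to be a geodesic.\<close>

lemma arc_between_Lipschitz:
  fixes X :: "'a metric" and \<sigma> :: "real \<Rightarrow> 'a"
  assumes D: "D > 0" and \<sigma>: "\<sigma> \<in> {0..D} \<rightarrow> mspace X" "inj_on \<sigma> {0..D}"
    and Lip: "\<And>s t. \<lbrakk>0 \<le> s; s \<le> t; t \<le> D\<rbrakk> \<Longrightarrow> mdist X (\<sigma> s) (\<sigma> t) \<le> t - s"
  shows "arc_between (mtopology_of X) (\<sigma> 0) (\<sigma> D) (\<sigma> ` {0..D})"
proof -
  define g where "g = (\<lambda>t. \<sigma> (D * t))"
  have in_D: "D * t \<in> {0..D}" if "t \<in> {0..1}" for t
    using that D by (auto simp: mult_left_le)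
  have img: "(\<lambda>t. D * t) ` {0..1} = {0..D}"
    using D by (simp add: image_mult_atLeastAtMost)
  have L: "mdist X (\<sigma> s) (\<sigma> t) \<le> \<bar>s - t\<bar>" if "s \<in> {0..D}" "t \<in> {0..D}" for s t
    using that Lip[of s t] Lip[of t s] by (cases "s \<le> t") (auto simp: mdist_commute)
  have "Lipschitz_continuous_map (submetric euclidean_metric {0..1}) X g"
    unfolding Lipschitz_continuous_map_def
  proof (intro conjI exI ballI)
    show "g \<in> mspace (submetric euclidean_metric {0..1}) \<rightarrow> mspace X"
      using in_D \<sigma>(1) by (auto simp: g_def)
    fix s t :: real assume "s \<in> mspace (submetric euclidean_metric {0..1})"
      "t \<in> mspace (submetric euclidean_metric {0..1::real})"
    then have "mdist X (g s) (g t) \<le> \<bar>D * s - D * t\<bar>"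
      unfolding g_def by (intro L in_D) auto
    also have "\<dots> = D * \<bar>s - t\<bar>"
      using D by (simp add: abs_mult flip: right_diff_distrib)
    finally show "mdist X (g s) (g t) \<le> D * mdist (submetric euclidean_metric {0..1}) s t"
      by (simp add: dist_real_def)
  qed
  then have "pathin (mtopology_of X) g"
    unfolding pathin_def
    by (metis Lipschitz_continuous_imp_continuous_map mtopology_of_euclidean mtopology_of_submetric)
  moreover have "inj_on g {0..1}"
  proof (rule inj_onI)
    fix s t :: real assume "s \<in> {0..1}" "t \<in> {0..1}" "g s = g t"
    then have "D * s = D * t"
      unfolding g_def by (intro inj_onD[OF \<sigma>(2)] in_D)
    with D show "s = t"
      by simp
  qed
  moreover have "\<sigma> ` {0..D} = g ` {0..1}"
    unfolding img[symmetric] image_image g_def ..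
  ultimately show ?thesis
    unfolding arc_between_def by (intro exI[of _ g]) (auto simp: g_def)
qed

text \<open>The value \<open>anc x t\<close> is the point at distance \<open>t\<close> from the root \<open>o'\<close> on the geodesic to \<open>x\<close>. The
  last clause is 0-hyperbolicity: geodesics that have parted do not meet again.\<close>

lemma metric_tree_ancestors:
  fixes X :: "'a metric"
  assumes T: "metric_tree X" and o': "o' \<in> mspace X"
  obtains anc :: "'a \<Rightarrow> real \<Rightarrow> 'a"
  where "\<And>x. x \<in> mspace X \<Longrightarrow> anc x 0 = o'"
    and "\<And>x t. \<lbrakk>x \<in> mspace X; 0 \<le> t; t \<le> mdist X o' x\<rbrakk> \<Longrightarrow>
           anc x t \<in> mspace X \<and> mdist X x (anc x t) = mdist X o' x - t"
    and "\<And>x y t. \<lbrakk>x \<in> mspace X; y \<in> mspace X; 0 \<le> t; t \<le> mdist X o' x; t \<le> mdist X o' y;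
           anc x t \<noteq> anc y t\<rbrakk> \<Longrightarrow> mdist X o' x + mdist X o' y - 2 * t \<le> mdist X x y"
proof -
  define h where "h = mdist X o'"
  have geo: "\<exists>g. g \<in> {0..mdist X x y} \<rightarrow> mspace X \<and> g 0 = x \<and> g (mdist X x y) = y \<and>
        (\<forall>s\<in>{0..mdist X x y}. \<forall>t\<in>{0..mdist X x y}. mdist X (g s) (g t) = \<bar>s - t\<bar>)"
    if "x \<in> mspace X" "y \<in> mspace X" for x y
    using T that unfolding metric_tree_def geodesic_metric_def by blast
  have unique: "A = B" if "arc_between (mtopology_of X) x y A" "arc_between (mtopology_of X) x y B"
    "x \<in> mspace X" "y \<in> mspace X" "x \<noteq> y" for x y A B
    using T that unfolding metric_tree_def by blast
  have "\<exists>anc. \<forall>x\<in>mspace X. anc x \<in> {0..h x} \<rightarrow> mspace X \<and> anc x 0 = o' \<and> anc x (h x) = x \<and>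
        (\<forall>s\<in>{0..h x}. \<forall>t\<in>{0..h x}. mdist X (anc x s) (anc x t) = \<bar>s - t\<bar>)"
    using geo[OF o'] unfolding h_def by (intro bchoice ballI) blast
  then obtain anc where anc: "anc x \<in> {0..h x} \<rightarrow> mspace X" "anc x 0 = o'" "anc x (h x) = x"
      "\<forall>s\<in>{0..h x}. \<forall>t\<in>{0..h x}. mdist X (anc x s) (anc x t) = \<bar>s - t\<bar>"
      if "x \<in> mspace X" for x
    by blast
  have h0: "h x \<ge> 0" for x
    by (simp add: h_def)
  have mem: "anc x t \<in> mspace X" if "x \<in> mspace X" "0 \<le> t" "t \<le> h x" for x t
    using anc(1)[OF that(1)] that by auto
  have dist: "mdist X (anc x s) (anc x t) = \<bar>s - t\<bar>"
    if "x \<in> mspace X" "0 \<le> s" "s \<le> h x" "0 \<le> t" "t \<le> h x" for x s t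
    using anc(4)[OF that(1)] that by auto
  have height: "h (anc x t) = t" if "x \<in> mspace X" "0 \<le> t" "t \<le> h x" for x t
    using dist[of x 0 t] that anc(2)[OF that(1)] h0[of x] by (simp add: h_def)
  have height_eq: "s = t" if "anc x s = anc y t" "x \<in> mspace X" "y \<in> mspace X"
      "0 \<le> s" "s \<le> h x" "0 \<le> t" "t \<le> h y" for x y s t
    using that height by metis
  \<comment> \<open>Up to height \<open>c\<close> both geodesics are arcs from the root to the same
    point, hence equal as sets; the parameter is the distance to the root, so they agree
    pointwise.\<close>
  have below: "anc x t = anc y t" if eq: "anc x c = anc y c" and xy: "x \<in> mspace X" "y \<in> mspace X"
    and t: "0 \<le> t" "t \<le> c" and c: "c \<le> h x" "c \<le> h y" for x y c t
  proof (cases "c = 0")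
    case True
    then show ?thesis using t anc(2) xy by simp
  next
    case False
    have "arc_between (mtopology_of X) (anc z 0) (anc z c) (anc z ` {0..c})"
      if z: "z \<in> mspace X" "c \<le> h z" for z
    proof (rule arc_between_Lipschitz)
      show "inj_on (anc z) {0..c}"
        using height_eq[OF _ z(1) z(1)] z(2) by (intro inj_onI) auto
    qed (use z False t dist mem in auto)
    then have "arc_between (mtopology_of X) o' (anc y c) (anc x ` {0..c})"
        "arc_between (mtopology_of X) o' (anc y c) (anc y ` {0..c})"
      using xy c eq anc(2) by metis+
    moreover have "h (anc y c) = c" "h o' = 0" "anc y c \<in> mspace X"
      using height[of y c] mem[of y c] xy c t o' by (auto simp: h_def)
    then have "o' \<noteq> anc y c"
      using False by auto
    ultimately have "anc x ` {0..c} = anc y ` {0..c}"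
      using unique o' \<open>anc y c \<in> mspace X\<close> by blast
    moreover have "anc x t \<in> anc x ` {0..c}"
      using t by simp
    ultimately obtain s where "s \<in> {0..c}" "anc x t = anc y s"
      by (metis imageE)
    with height_eq[of x t y s] xy t c show ?thesis
      by auto
  qed
  have apart: "h x + h y - 2 * t \<le> mdist X x y"
    if xy: "x \<in> mspace X" "y \<in> mspace X" and t: "0 \<le> t" "t \<le> h x" "t \<le> h y"
      and ne: "anc x t \<noteq> anc y t" for x y t
  proof -
    define S where "S = {s. 0 \<le> s \<and> s \<le> h x \<and> s \<le> h y \<and> anc x s = anc y s}"
    \<comment> \<open>The height of the branch point. The supremum is attained because both
      geodesics are 1-Lipschitz.\<close>
    define c where "c = Sup S"
    have bdd: "bdd_above S"
      unfolding S_def bdd_above_def by auto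
    have "0 \<in> S"
      using anc(2) xy h0 unfolding S_def by auto
    then have c0: "0 \<le> c"
      using bdd cSup_upper unfolding c_def by auto
    have Slt: "s < t" if "s \<in> S" for s
      using that below[of x s y t] ne xy t unfolding S_def by force
    then have ct: "c \<le> t"
      using \<open>0 \<in> S\<close> unfolding c_def by (intro cSup_least) (auto intro: less_imp_le)
    have "anc x c = anc y c"
    proof (rule ccontr)
      assume "anc x c \<noteq> anc y c"
      then have e: "mdist X (anc x c) (anc y c) > 0"
        using mem[of x c] mem[of y c] xy c0 ct t mdist_zero[of "anc x c" X "anc y c"]
          mdist_nonneg[of X "anc x c" "anc y c"] by (auto simp: less_le)
      define e where "e = mdist X (anc x c) (anc y c)"
      have "c - e/2 < Sup S"
        using e unfolding c_def e_def by simp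
      then obtain s where s: "s \<in> S" "c - e/2 < s"
        using \<open>0 \<in> S\<close> by (metis empty_iff less_cSupE)
      have sc: "s \<le> c"
        using s bdd cSup_upper unfolding c_def by auto
      have sS: "0 \<le> s" "anc x s = anc y s" "s \<le> h x" "s \<le> h y"
        using s unfolding S_def by auto
      have "e \<le> mdist X (anc x c) (anc x s) + mdist X (anc y s) (anc y c)"
        using mdist_triangle[of "anc x c" X "anc x s" "anc y c"] mem xy c0 ct t sS
        unfolding e_def by simp
      also have "\<dots> = 2 * (c - s)"
        using dist[of x c s] dist[of y s c] xy c0 ct t sS sc by simp
      finally show False
        using s by simp
    qed
    then have meet: "anc x c = anc y c" .
    have parted: "anc x s \<noteq> anc y s" if "c < s" "s \<le> h x" "s \<le> h y" for s
      using cSup_upper[OF _ bdd, of s] that c0 unfolding c_def S_def by force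
    define D where "D = h x + h y - 2 * c"
    define a where "a = h x - c"
    \<comment> \<open>Down from \<open>x\<close> to the branch point, reached at parameter
      \<open>a\<close>, then up to \<open>y\<close>. Heights separate the points of each leg and
      \<open>parted\<close> separates the legs, so this is an arc.\<close>
    define \<sigma> where "\<sigma> = (\<lambda>\<tau>. if \<tau> \<le> a then anc x (h x - \<tau>) else anc y (c + (\<tau> - a)))"
    have a: "0 \<le> a" "a \<le> D"
      using ct t by (simp_all add: a_def D_def)
    have ends: "\<sigma> 0 = x" "\<sigma> D = y"
      using a anc(3) xy meet unfolding \<sigma>_def by (auto simp: a_def D_def)
    have "x \<noteq> y"
      using ne by auto
    then have D: "D > 0"
      using a ends unfolding less_le by auto
    have \<sigma>: "\<sigma> \<in> {0..D} \<rightarrow> mspace X"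
      using mem xy c0 ct t unfolding \<sigma>_def by (auto simp: a_def D_def)
    have "arc_between (mtopology_of X) (\<sigma> 0) (\<sigma> D) (\<sigma> ` {0..D})"
    proof (rule arc_between_Lipschitz[OF D \<sigma>])
      have "\<not> (u \<le> a \<and> \<not> v \<le> a \<and> \<sigma> u = \<sigma> v)" if "u \<in> {0..D}" "v \<in> {0..D}" for u v
      proof
        assume uv: "u \<le> a \<and> \<not> v \<le> a \<and> \<sigma> u = \<sigma> v"
        then have *: "anc x (h x - u) = anc y (c + (v - a))"
          by (auto simp: \<sigma>_def)
        have "h x - u = c + (v - a)"
          by (rule height_eq[OF *]) (use uv that xy c0 ct t in \<open>auto simp: a_def D_def\<close>)
        with * parted[of "h x - u"] uv that show False
          by (auto simp: a_def D_def)
      qed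
      moreover have "u = v" if "u \<in> {0..D}" "v \<in> {0..D}" "u \<le> a" "v \<le> a" "\<sigma> u = \<sigma> v" for u v
        using height_eq[of x "h x - u" x "h x - v"] that xy c0 by (auto simp: \<sigma>_def a_def)
      moreover have "u = v" if "u \<in> {0..D}" "v \<in> {0..D}" "\<not> u \<le> a" "\<not> v \<le> a" "\<sigma> u = \<sigma> v" for u v
        using height_eq[of y "c + (u - a)" y "c + (v - a)"] that xy c0
        by (auto simp: \<sigma>_def a_def D_def)
      ultimately show "inj_on \<sigma> {0..D}"
        unfolding inj_on_def by metis
    next
      fix u v assume uv: "0 \<le> u" "u \<le> v" "v \<le> D"
      consider "v \<le> a" | "a < u" | "u \<le> a" "a < v"
        by linarith
      then show "mdist X (\<sigma> u) (\<sigma> v) \<le> v - u"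
      proof cases
        case 1
        then show ?thesis
          using dist[of x "h x - u" "h x - v"] uv xy c0 by (auto simp: \<sigma>_def a_def)
      next
        case 2
        then show ?thesis
          using dist[of y "c + (u - a)" "c + (v - a)"] uv xy c0 by (auto simp: \<sigma>_def a_def D_def)
      next
        case 3
        have "mdist X (\<sigma> u) (\<sigma> v) \<le> mdist X (\<sigma> u) (anc x c) + mdist X (anc x c) (\<sigma> v)"
          using uv \<sigma> mem[of x c] xy c0 ct t by (intro mdist_triangle) auto
        also have "mdist X (\<sigma> u) (anc x c) = a - u"
          using 3 dist[of x "h x - u" c] uv xy c0 ct t by (auto simp: \<sigma>_def a_def)
        also have "mdist X (anc x c) (\<sigma> v) = v - a"
          using 3 dist[of y c "c + (v - a)"] uv xy c0 ct t by (auto simp: \<sigma>_def a_def D_def meet)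
        finally show ?thesis
          by simp
      qed
    qed
    moreover obtain g where g: "g \<in> {0..mdist X x y} \<rightarrow> mspace X" "g 0 = x" "g (mdist X x y) = y"
        "\<forall>s\<in>{0..mdist X x y}. \<forall>t\<in>{0..mdist X x y}. mdist X (g s) (g t) = \<bar>s - t\<bar>"
      using geo[OF xy] by blast
    have dxy: "mdist X x y > 0"
      using \<open>x \<noteq> y\<close> xy mdist_zero[of x X y] mdist_nonneg[of X x y] by (auto simp: less_le)
    have "arc_between (mtopology_of X) (g 0) (g (mdist X x y)) (g ` {0..mdist X x y})"
    proof (rule arc_between_Lipschitz[OF dxy g(1)])
      show "inj_on g {0..mdist X x y}"
      proof (rule inj_onI)
        fix s t assume st: "s \<in> {0..mdist X x y}" "t \<in> {0..mdist X x y}" "g s = g t"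
        then have "mdist X (g s) (g t) = 0"
          using g(1) by (subst mdist_zero) auto
        moreover have "mdist X (g s) (g t) = \<bar>s - t\<bar>"
          using g(4) st(1,2) by blast
        ultimately show "s = t" by simp
      qed
    qed (use g(4) in auto)
    \<comment> \<open>Uniqueness of arcs puts the branch point on a geodesic from \<open>x\<close>
      to \<open>y\<close>. The distance is therefore exactly \<open>h x + h y - 2 * c\<close>, and
      \<open>c \<le> t\<close>.\<close>
    ultimately have "\<sigma> ` {0..D} = g ` {0..mdist X x y}"
      using unique[OF _ _ xy \<open>x \<noteq> y\<close>] g(2,3) ends by metis
    moreover have "\<sigma> a = anc x c"
      by (simp add: \<sigma>_def a_def)
    ultimately obtain s where s: "s \<in> {0..mdist X x y}" "g s = anc x c"
      using a by (metis (no_types, lifting) atLeastAtMost_iff image_iff)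
    have "mdist X x (anc x c) = s" "mdist X (anc x c) y = mdist X x y - s"
      using g(4)[rule_format, of 0 s] g(4)[rule_format, of s "mdist X x y"] s g(2,3) dxy by auto
    moreover have "mdist X x (anc x c) = h x - c" "mdist X y (anc y c) = h y - c"
      using dist[of x "h x" c] dist[of y "h y" c] anc(3) xy c0 ct t by auto
    ultimately show ?thesis
      using meet ct by (simp add: mdist_commute)
  qed
  show thesis
  proof
    fix x t assume "x \<in> mspace X" "0 \<le> t" "t \<le> mdist X o' x"
    then show "anc x t \<in> mspace X \<and> mdist X x (anc x t) = mdist X o' x - t"
      using mem[of x t] dist[of x "h x" t] anc(3)[of x] by (auto simp: h_def)
  qed (use apart anc(2) in \<open>simp_all add: h_def\<close>)
qed

text \<open>Colour \<open>c\<close> omits the annuli \<open>[(j n + c) g, (j n + c + 1) g)\<close> around a root. What is left of it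
  between two omitted annuli is cut up according to the ancestors at the bottom of the lower one.\<close>

lemma metric_tree_coloring:
  fixes X :: "'a metric" and n :: nat and g :: real
  assumes T: "metric_tree X" and ne: "mspace X \<noteq> {}" and n: "n \<ge> 1" and g: "g > 0"
  obtains bad :: "'a \<Rightarrow> nat" and cl :: "nat \<Rightarrow> 'a \<Rightarrow> int \<times> 'a"
  where "\<And>c x y. \<lbrakk>c < n; x \<in> mspace X; y \<in> mspace X; bad x \<noteq> c; bad y \<noteq> c; mdist X x y < g\<rbrakk>
           \<Longrightarrow> cl c x = cl c y"
    and "\<And>c x y. \<lbrakk>c < n; x \<in> mspace X; y \<in> mspace X; cl c x = cl c y\<rbrakk>
           \<Longrightarrow> mdist X x y \<le> 2 * n * g"
proof -
  obtain r where r: "r \<in> mspace X"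
    using ne by blast
  obtain anc where anc0: "\<And>x. x \<in> mspace X \<Longrightarrow> anc x 0 = r"
    and anc: "\<And>x t. \<lbrakk>x \<in> mspace X; 0 \<le> t; t \<le> mdist X r x\<rbrakk> \<Longrightarrow>
           anc x t \<in> mspace X \<and> mdist X x (anc x t) = mdist X r x - t"
    and apart: "\<And>x y t. \<lbrakk>x \<in> mspace X; y \<in> mspace X; 0 \<le> t; t \<le> mdist X r x; t \<le> mdist X r y;
           anc x t \<noteq> anc y t\<rbrakk> \<Longrightarrow> mdist X r x + mdist X r y - 2 * t \<le> mdist X x y"
    by (rule metric_tree_ancestors[OF T r]) (rule that)
  define h where "h = mdist X r"
  \<comment> \<open>\<open>w\<close> numbers the annuli of width \<open>g\<close>, and
    \<open>bad\<close> is the one colour that omits the annulus of the point. \<open>j c\<close>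
    numbers the blocks of \<open>n\<close> annuli that start with one omitted by colour
    \<open>c\<close>; \<open>base\<close> is the height at which a block starts, raised to 0 if that
    is below the root.\<close>
  define w where "w = (\<lambda>x. \<lfloor>h x / g\<rfloor>)"
  define j where "j = (\<lambda>c x. (w x - int c) div int n)"
  define base where "base = (\<lambda>c i. max 0 (of_int (i * int n + int c) * g))"
  define bad where "bad = (\<lambda>x. nat (w x mod int n))"
  define cl where "cl = (\<lambda>c x. (j c x, anc x (base c (j c x))))"
  have h0: "h x \<ge> 0" for x
    by (simp add: h_def)
  have w: "of_int (w x) * g \<le> h x" "h x < (of_int (w x) + 1) * g" for x
    using g floor_divide_lower[OF g, of "h x"] floor_divide_upper[OF g, of "h x"]
    by (simp_all add: w_def)
  have j: "j c x * int n + int c \<le> w x" "w x < j c x * int n + int c + int n" for c x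
  proof -
    have "j c x * int n + (w x - int c) mod int n = w x - int c"
      unfolding j_def by simp
    moreover have "0 \<le> (w x - int c) mod int n" "(w x - int c) mod int n < int n"
      using n by simp_all
    ultimately show "j c x * int n + int c \<le> w x" "w x < j c x * int n + int c + int n"
      by linarith+
  qed
  have j': "j c x * int n + int c < w x" if "c < n" "bad x \<noteq> c" for c x
  proof (rule ccontr)
    assume "\<not> ?thesis"
    then have "w x = j c x * int n + int c"
      using j(1)[of c x] by linarith
    then show False
      using that by (simp add: bad_def)
  qed
  have base: "0 \<le> base c (j c x)" "base c (j c x) \<le> h x" for c x
  proof -
    have "of_int (j c x * int n + int c) * g \<le> of_int (w x) * g"
      using j(1)[of c x] g by (intro mult_right_mono) (simp_all only: of_int_le_iff less_imp_le)
    then show "base c (j c x) \<le> h x"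
      using w(1)[of x] h0 unfolding base_def by simp
  qed (simp add: base_def)
  show thesis
  proof
    fix c x y
    assume c: "c < n" and xy: "x \<in> mspace X" "y \<in> mspace X" and b: "bad x \<noteq> c" "bad y \<noteq> c"
      and d: "mdist X x y < g"
    have "\<bar>h x - h y\<bar> < g"
      using d mdist_triangle[OF r xy] mdist_triangle[OF r xy(2,1)] xy
      by (simp add: h_def mdist_commute abs_less_iff)
    then have "of_int (w x) * g < (of_int (w y) + 2) * g" "of_int (w y) * g < (of_int (w x) + 2) * g"
      using w[of x] w[of y] by (auto simp: algebra_simps)
    then have wxy: "w x \<le> w y + 1" "w y \<le> w x + 1"
      using g by simp_all
    \<comment> \<open>Entering the next block means passing its lowest annulus, which colour
      \<open>c\<close> omits, so \<open>w\<close> would have to grow by at least 2.\<close>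
    have "\<not> j c x < j c y" if "w y \<le> w x + 1" "bad x \<noteq> c" "bad y \<noteq> c" for x y
    proof
      assume "j c x < j c y"
      then have "(j c x + 1) * int n \<le> j c y * int n"
        by (intro mult_right_mono) auto
      then show False
        using j(2)[of x c] j'[OF c that(3)] that(1) by (simp add: algebra_simps)
    qed
    then have jj: "j c x = j c y"
      using wxy b by (metis linorder_neqE)
    define t where "t = base c (j c x)"
    have t: "0 \<le> t" "t \<le> h x" "t \<le> h y"
      using base[of c x] base[of c y] jj unfolding t_def by simp_all
    \<comment> \<open>Both points lie above the omitted annulus, at least \<open>g\<close> above
      \<open>t\<close>; if their ancestors at height \<open>t\<close> differed, their distance would
      be at least \<open>2 * g\<close>. For \<open>t = 0\<close> both ancestors are the
      root.\<close>
    have "anc x t = anc y t"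
    proof (rule ccontr)
      assume neq: "anc x t \<noteq> anc y t"
      then have "t \<noteq> 0"
        using anc0 xy by metis
      then have t_eq: "t = of_int (j c x * int n + int c) * g"
        unfolding t_def base_def by (simp add: max_def split: if_splits)
      have "t + g \<le> h z" if "z = x \<or> z = y" for z
      proof -
        have "of_int (j c x * int n + int c + 1) * g \<le> of_int (w z) * g"
          using j'[OF c b(1)] j'[OF c b(2)] jj g that
          by (intro mult_right_mono) (auto simp del: of_int_add of_int_mult)
        then show ?thesis
          using w(1)[of z] unfolding t_eq by (simp add: algebra_simps)
      qed
      then have "t + g \<le> h x" "t + g \<le> h y"
        by blast+
      with apart[OF xy t[unfolded h_def] neq] d g show False
        by (simp add: h_def)
    qed
    then show "cl c x = cl c y"
      using jj by (simp add: cl_def t_def)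
  next
    fix c x y
    assume c: "c < n" and xy: "x \<in> mspace X" "y \<in> mspace X" and eq: "cl c x = cl c y"
    define t where "t = base c (j c x)"
    have jj: "j c x = j c y" and a: "anc x t = anc y t"
      using eq by (auto simp: cl_def t_def)
    have t: "0 \<le> t" "t \<le> h x" "t \<le> h y"
      using base[of c x] base[of c y] jj unfolding t_def by simp_all
    \<comment> \<open>A block has \<open>n\<close> annuli, so each point is within
      \<open>n * g\<close> of its ancestor at the base, which \<open>x\<close> and \<open>y\<close>
      share.\<close>
    have "h z - t \<le> n * g" if "j c z = j c x" for z
    proof -
      have "h z \<le> (of_int (w z) + 1) * g"
        using w(2)[of z] by simp
      also have "(of_int (w z) + 1) * g \<le> of_int (j c x * int n + int c + int n) * g"
      proof (rule mult_right_mono)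
        have "w z + 1 \<le> j c x * int n + int c + int n"
          using j(2)[of z c] that by simp
        then show "of_int (w z) + 1 \<le> (of_int (j c x * int n + int c + int n) :: real)"
          by (metis of_int_1 of_int_add of_int_le_iff)
      qed (use g in simp)
      also have "\<dots> \<le> t + n * g"
        unfolding t_def base_def by (simp add: algebra_simps)
      finally show ?thesis by simp
    qed
    then have "h x - t \<le> n * g" "h y - t \<le> n * g"
      using jj by auto
    moreover have "mdist X x y \<le> (h x - t) + (h y - t)"
      using mdist_triangle[of x X "anc x t" y] anc[of x t] anc[of y t] xy t a
      by (simp add: h_def mdist_commute)
    ultimately show "mdist X x y \<le> 2 * n * g"
      by simp
  qed
qed

text \<open>Each factor forbids one of the \<open>n\<close> colours at each point, so \<open>n - 1\<close> factors leave one.\<close>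

lemma tree_product_coloring:
  fixes T :: "nat \<Rightarrow> 'a metric" and n :: nat and g :: real
  assumes T: "\<And>i. i \<in> {1..n - 1} \<Longrightarrow> metric_tree (T i)"
    and ne: "\<And>i. i \<in> {1..n - 1} \<Longrightarrow> mspace (T i) \<noteq> {}" and n: "n \<ge> 1" and g: "g > 0"
  obtains col :: "(nat \<Rightarrow> 'a) \<Rightarrow> nat"
  where "\<And>x. col x < n"
    and "\<And>c x y. (\<lambda>x y. x \<in> (\<Pi>\<^sub>E i\<in>{1..n - 1}. mspace (T i)) \<and> y \<in> (\<Pi>\<^sub>E i\<in>{1..n - 1}. mspace (T i)) \<and>
            col x = c \<and> col y = c \<and> (\<forall>i\<in>{1..n - 1}. mdist (T i) (x i) (y i) < g))\<^sup>*\<^sup>* x y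
         \<Longrightarrow> x \<in> (\<Pi>\<^sub>E i\<in>{1..n - 1}. mspace (T i))
         \<Longrightarrow> \<forall>i\<in>{1..n - 1}. mdist (T i) (x i) (y i) \<le> 2 * n * g"
proof -
  define P where "P = (\<Pi>\<^sub>E i\<in>{1..n - 1}. mspace (T i))"
  define Q where "Q = (\<lambda>i bad (cl :: nat \<Rightarrow> 'a \<Rightarrow> int \<times> 'a).
     (\<forall>c<n. \<forall>x\<in>mspace (T i). \<forall>y\<in>mspace (T i). bad x \<noteq> c \<longrightarrow> bad y \<noteq> c \<longrightarrow>
        mdist (T i) x y < g \<longrightarrow> cl c x = cl c y) \<and>
     (\<forall>c<n. \<forall>x\<in>mspace (T i). \<forall>y\<in>mspace (T i). cl c x = cl c y \<longrightarrow> mdist (T i) x y \<le> 2 * n * g))"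
  have "\<exists>bc. Q i (fst bc) (snd bc)" if i: "i \<in> {1..n - 1}" for i
  proof -
    obtain bad and cl :: "nat \<Rightarrow> 'a \<Rightarrow> int \<times> 'a" where
      "\<And>c x y. \<lbrakk>c < n; x \<in> mspace (T i); y \<in> mspace (T i); bad x \<noteq> c; bad y \<noteq> c; mdist (T i) x y < g\<rbrakk>
           \<Longrightarrow> cl c x = cl c y"
      "\<And>c x y. \<lbrakk>c < n; x \<in> mspace (T i); y \<in> mspace (T i); cl c x = cl c y\<rbrakk>
           \<Longrightarrow> mdist (T i) x y \<le> 2 * n * g"
      by (rule metric_tree_coloring[OF T[OF i] ne[OF i] n g]) (rule that)
    then have "Q i bad cl"
      unfolding Q_def by simp
    then show ?thesis
      by (intro exI[of _ "(bad, cl)"]) simp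
  qed
  then obtain bc where "\<And>i. i \<in> {1..n - 1} \<Longrightarrow> Q i (fst (bc i)) (snd (bc i))"
    by metis
  then obtain bad cl where Q: "\<And>i. i \<in> {1..n - 1} \<Longrightarrow> Q i (bad i) (cl i)"
    by (rule that)
  have close: "cl i c x = cl i c y" if "i \<in> {1..n - 1}" "c < n" "x \<in> mspace (T i)" "y \<in> mspace (T i)"
    "bad i x \<noteq> c" "bad i y \<noteq> c" "mdist (T i) x y < g" for i c x y
    using Q[OF that(1)] that unfolding Q_def by simp
  have diam: "mdist (T i) x y \<le> 2 * n * g" if "i \<in> {1..n - 1}" "c < n" "x \<in> mspace (T i)"
    "y \<in> mspace (T i)" "cl i c x = cl i c y" for i c x y
    using Q[OF that(1)] that unfolding Q_def by blast
  have "\<exists>c<n. \<forall>i\<in>{1..n - 1}. bad i (x i) \<noteq> c" for x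
  proof (rule ccontr)
    assume "\<not> ?thesis"
    then have "{..<n} \<subseteq> (\<lambda>i. bad i (x i)) ` {1..n - 1}"
      by blast
    then have "card {..<n} \<le> card {1..n - 1}"
      by (rule surj_card_le[rotated]) simp
    with n show False by simp
  qed
  then have "\<exists>col. \<forall>x. col x < n \<and> (\<forall>i\<in>{1..n - 1}. bad i (x i) \<noteq> col x)"
    by (intro choice) blast
  then obtain col where col: "\<And>x. col x < n" "\<And>x i. i \<in> {1..n - 1} \<Longrightarrow> bad i (x i) \<noteq> col x"
    by blast
  show thesis
  proof
    show "col x < n" for x by (rule col(1))
  next
    fix c x y
    assume chain: "(\<lambda>x y. x \<in> (\<Pi>\<^sub>E i\<in>{1..n - 1}. mspace (T i)) \<and> y \<in> (\<Pi>\<^sub>E i\<in>{1..n - 1}. mspace (T i)) \<and>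
            col x = c \<and> col y = c \<and> (\<forall>i\<in>{1..n - 1}. mdist (T i) (x i) (y i) < g))\<^sup>*\<^sup>* x y"
      and x: "x \<in> (\<Pi>\<^sub>E i\<in>{1..n - 1}. mspace (T i))"
    \<comment> \<open>The class \<open>cl i c\<close> is preserved along a chain, because no point
      of colour \<open>c\<close> has a coordinate that is bad for \<open>c\<close>. The case
      \<open>x = y\<close> covers the empty chain, where nothing is known about the colour of
      \<open>x\<close>.\<close>
    have "x = y \<or> (c < n \<and> y \<in> P \<and> (\<forall>i\<in>{1..n - 1}. cl i c (x i) = cl i c (y i)))"
      using chain
    proof (induction rule: rtranclp_induct)
      case (step y z)
      then have yz: "y \<in> P" "z \<in> P" "col y = c" "col z = c" "c < n"
          "\<forall>i\<in>{1..n - 1}. mdist (T i) (y i) (z i) < g"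
        using col(1) by (auto simp: P_def)
      have "cl i c (y i) = cl i c (z i)" if i: "i \<in> {1..n - 1}" for i
      proof -
        have "y i \<in> mspace (T i)" "z i \<in> mspace (T i)"
          using yz i by (auto simp: P_def)
        then show ?thesis
          using close[OF i] col(2)[OF i, of y] col(2)[OF i, of z] yz i by simp
      qed
      then show ?case
        using step.IH yz by auto
    qed simp
    then show "\<forall>i\<in>{1..n - 1}. mdist (T i) (x i) (y i) \<le> 2 * n * g"
    proof
      assume "x = y"
      show ?thesis
      proof
        fix i assume "i \<in> {1..n - 1}"
        then have "mdist (T i) (x i) (x i) = 0"
          using x by (subst mdist_zero) auto
        then show "mdist (T i) (x i) (y i) \<le> 2 * n * g"
          using g \<open>x = y\<close> by simp
      qed
    next
      assume *: "c < n \<and> y \<in> P \<and> (\<forall>i\<in>{1..n - 1}. cl i c (x i) = cl i c (y i))"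
      show ?thesis
      proof
        fix i assume i: "i \<in> {1..n - 1}"
        have "x i \<in> mspace (T i)" "y i \<in> mspace (T i)"
          using * x i by (auto simp: P_def)
        then show "mdist (T i) (x i) (y i) \<le> 2 * n * g"
          using diam[OF i, of c "x i" "y i"] * i by simp
      qed
    qed
  qed
qed

section \<open>Packing in Euclidean space\<close>

text \<open>Pigeonhole on a grid of mesh \<open>\<epsilon>\<close>: two points in one cell have
  distance at most \<open>m * \<epsilon>\<close> in the sum, and dividing \<delta> by
  \<open>m + 1\<close> makes this less than \<delta>, also for \<open>m = 0\<close>. Coordinates
  relative to \<open>a0\<close> lie in \<open>[-D, D]\<close>, which meets at most
  \<open>2 * D / \<epsilon> + 2\<close> grid intervals.\<close>

lemma card_separated_le:
  fixes G :: "'b \<Rightarrow> nat \<Rightarrow> real"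
  assumes J: "finite J" and \<delta>: "\<delta> > 0" and D: "D \<ge> 0"
    and bdd: "\<And>a b j. \<lbrakk>a \<in> J; b \<in> J; j \<in> {1..m}\<rbrakk> \<Longrightarrow> \<bar>G a j - G b j\<bar> \<le> D"
    and sep: "\<And>a b. \<lbrakk>a \<in> J; b \<in> J; a \<noteq> b\<rbrakk> \<Longrightarrow> \<delta> \<le> (\<Sum>j=1..m. \<bar>G a j - G b j\<bar>)"
  shows "card J \<le> (2 * D * (m + 1) / \<delta> + 2) ^ m"
proof (cases "J = {}")
  case True
  then show ?thesis
    using \<delta> D by simp
next
  case False
  then obtain a0 where a0: "a0 \<in> J"
    by blast
  define \<epsilon> where "\<epsilon> = \<delta> / (m + 1)"
  have \<epsilon>: "\<epsilon> > 0"
    using \<delta> by (simp add: \<epsilon>_def)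
  define \<phi> where "\<phi> = (\<lambda>a. \<lambda>j\<in>{1..m}. \<lfloor>(G a j - G a0 j) / \<epsilon>\<rfloor>)"
  define I where "I = {\<lfloor>- (D / \<epsilon>)\<rfloor>..\<lfloor>D / \<epsilon>\<rfloor>}"
  have "inj_on \<phi> J"
  proof (rule inj_onI, rule ccontr)
    fix a b assume ab: "a \<in> J" "b \<in> J" "\<phi> a = \<phi> b" "a \<noteq> b"
    have "\<bar>G a j - G b j\<bar> \<le> \<epsilon>" if "j \<in> {1..m}" for j
    proof -
      have "\<lfloor>(G a j - G a0 j) / \<epsilon>\<rfloor> = \<lfloor>(G b j - G a0 j) / \<epsilon>\<rfloor>"
        using fun_cong[OF ab(3), of j] that by (simp add: \<phi>_def)
      then have "\<bar>(G a j - G a0 j) / \<epsilon> - (G b j - G a0 j) / \<epsilon>\<bar> \<le> 1"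
        by linarith
      also have "(G a j - G a0 j) / \<epsilon> - (G b j - G a0 j) / \<epsilon> = (G a j - G b j) / \<epsilon>"
        by (simp flip: diff_divide_distrib)
      finally show ?thesis
        using \<epsilon> by (simp add: abs_divide)
    qed
    then have "(\<Sum>j=1..m. \<bar>G a j - G b j\<bar>) \<le> (\<Sum>j=1..m. \<epsilon>)"
      by (rule sum_mono)
    also have "\<dots> < (m + 1) * \<epsilon>"
      using \<epsilon> by simp
    also have "\<dots> = \<delta>"
      by (simp add: \<epsilon>_def)
    finally show False
      using sep[OF ab(1,2,4)] by simp
  qed
  moreover have "\<phi> ` J \<subseteq> (\<Pi>\<^sub>E j\<in>{1..m}. I)"
  proof (rule image_subsetI, rule PiE_I)
    fix a j assume "a \<in> J" "j \<in> {1..m}"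
    then have "\<bar>(G a j - G a0 j) / \<epsilon>\<bar> \<le> D / \<epsilon>"
      using bdd[OF _ a0] \<epsilon> by (simp add: abs_divide divide_right_mono)
    then have "- (D / \<epsilon>) \<le> (G a j - G a0 j) / \<epsilon>" "(G a j - G a0 j) / \<epsilon> \<le> D / \<epsilon>"
      by (simp_all only: abs_le_iff) linarith
    then show "\<phi> a j \<in> I"
      using \<open>j \<in> {1..m}\<close> unfolding \<phi>_def I_def by (auto intro!: floor_mono)
  qed (auto simp: \<phi>_def)
  moreover have "finite (\<Pi>\<^sub>E j\<in>{1..m}. I)"
    by (intro finite_PiE) (auto simp: I_def)
  ultimately have "card J \<le> card (\<Pi>\<^sub>E j\<in>{1..m}. I)"
    by (metis card_image card_mono)
  also have "\<dots> = card I ^ m"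
    by (simp add: card_PiE)
  finally have "real (card J) \<le> real (card I) ^ m"
    by (metis of_nat_le_iff of_nat_power)
  also have "\<dots> \<le> (2 * D * (m + 1) / \<delta> + 2) ^ m"
  proof (rule power_mono)
    have D\<epsilon>: "D / \<epsilon> = D * (m + 1) / \<delta>"
      using \<delta> by (simp add: \<epsilon>_def)
    have "real (card I) = of_int (\<lfloor>D / \<epsilon>\<rfloor> - \<lfloor>- (D / \<epsilon>)\<rfloor> + 1)"
      using D \<epsilon> unfolding I_def by (simp add: floor_mono add_nonneg_nonneg)
    also have "\<dots> \<le> 2 * (D / \<epsilon>) + 2"
      by linarith
    finally show "real (card I) \<le> 2 * D * (m + 1) / \<delta> + 2"
      unfolding D\<epsilon> by simp
  qed simp
  finally show ?thesis
    by (simp add: add.commute)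
qed

section \<open>Horospherical coordinates\<close>

text \<open>The parameter \<open>t\<close> is the signed distance to the horosphere of height 1.\<close>

definition horo :: "nat \<Rightarrow> (nat \<Rightarrow> real) \<Rightarrow> real \<Rightarrow> nat \<Rightarrow> real" where
  "horo n u t = (\<lambda>i\<in>{1..n}. if i = n then exp (- t) else u i)"

lemma horo_in_carrier: "n \<ge> 1 \<Longrightarrow> horo n u t \<in> hyperbolic_carrier n"
  by (simp add: hyperbolic_carrier_def horo_def)

lemma cosh_dist_horo:
  assumes n: "n \<ge> 1"
  shows "cosh (hyperbolic_dist n (horo n u t) (horo n v t')) =
    1 + ((\<Sum>i=1..<n. (u i - v i)\<^sup>2) + (exp (- t) - exp (- t'))\<^sup>2) / (2 * exp (- t - t'))"
proof -
  have split: "{1..n} = insert n {1..<n}"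
    using n by auto
  have "(mdist (Euclidean_metric n) (horo n u t) (horo n v t'))\<^sup>2
      = (\<Sum>i=1..n. (horo n u t i - horo n v t' i)\<^sup>2)"
    by (simp add: L2_set_def sum_nonneg)
  also have "\<dots> = (exp (- t) - exp (- t'))\<^sup>2 + (\<Sum>i=1..<n. (horo n u t i - horo n v t' i)\<^sup>2)"
    unfolding split using n by (simp add: horo_def)
  also have "(\<Sum>i=1..<n. (horo n u t i - horo n v t' i)\<^sup>2) = (\<Sum>i=1..<n. (u i - v i)\<^sup>2)"
    by (rule sum.cong) (auto simp: horo_def)
  finally have "(mdist (Euclidean_metric n) (horo n u t) (horo n v t'))\<^sup>2
      = (\<Sum>i=1..<n. (u i - v i)\<^sup>2) + (exp (- t) - exp (- t'))\<^sup>2"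
    by simp
  moreover have "2 * horo n u t n * horo n v t' n = 2 * exp (- t - t')"
    using n by (simp add: horo_def mult_exp_exp)
  ultimately show ?thesis
    using cosh_hyperbolic_dist[OF horo_in_carrier horo_in_carrier, OF n n, of u t v t'] by simp
qed

lemma hyperbolic_dist_vertical:
  assumes n: "n \<ge> 1"
  shows "hyperbolic_dist n (horo n u t) (horo n u t') = \<bar>t - t'\<bar>"
proof -
  have "cosh (hyperbolic_dist n (horo n u t) (horo n u t')) =
      1 + (exp (- t) - exp (- t'))\<^sup>2 / (2 * exp (- t - t'))"
    using cosh_dist_horo[OF n, of u t u t'] by simp
  also have "\<dots> = ((exp (- t))\<^sup>2 + (exp (- t'))\<^sup>2) / (2 * exp (- t - t'))"
    by (simp add: field_simps power2_diff mult_exp_exp)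
  also have "\<dots> = (exp (t' - t) + exp (t - t')) / 2"
    by (simp add: field_simps power2_eq_square mult_exp_exp)
  also have "\<dots> = cosh \<bar>t - t'\<bar>"
    by (simp add: cosh_def abs_if)
  finally show ?thesis
    using hyperbolic_dist_nonneg[of n "horo n u t" "horo n u t'"]
    by (simp only: cosh_real_eq_iff abs_abs abs_of_nonneg)
qed

text \<open>Since \<open>cosh d - 1 = 2 * (sinh (d / 2))\<^sup>2\<close>, the distance formula makes
  \<open>sinh (d / 2)\<close> equal to \<open>exp t / 2\<close> times the Euclidean length of the
  horizontal displacement. The sum of absolute values bounds that length, and
  \<open>d / 2 \<le> sinh (d / 2)\<close>.\<close>

lemma hyperbolic_dist_horizontal:
  assumes n: "n \<ge> 1"
  shows "hyperbolic_dist n (horo n u t) (horo n v t) \<le> exp t * (\<Sum>i=1..<n. \<bar>u i - v i\<bar>)"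
proof -
  define d where "d = hyperbolic_dist n (horo n u t) (horo n v t)"
  define S where "S = (\<Sum>i=1..<n. \<bar>u i - v i\<bar>)"
  have d0: "d \<ge> 0" and S0: "S \<ge> 0"
    by (simp_all add: d_def S_def hyperbolic_dist_nonneg sum_nonneg)
  have "2 * (sinh (d / 2))\<^sup>2 = cosh d - 1"
    using cosh_double[of "d / 2"] cosh_square_eq[of "d / 2"] by simp
  also have "\<dots> = (\<Sum>i=1..<n. (u i - v i)\<^sup>2) / (2 * exp (- t - t))"
    using cosh_dist_horo[OF n, of u t v t] by (simp add: d_def)
  also have "(\<Sum>i=1..<n. (u i - v i)\<^sup>2) \<le> S\<^sup>2"
  proof -
    have "L2_set (\<lambda>i. u i - v i) {1..<n} \<le> S"
      unfolding S_def by (rule L2_set_le_sum_abs)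
    then have "(L2_set (\<lambda>i. u i - v i) {1..<n})\<^sup>2 \<le> S\<^sup>2"
      by (intro power_mono) auto
    then show ?thesis
      by (simp add: L2_set_def sum_nonneg)
  qed
  finally have "2 * (sinh (d / 2))\<^sup>2 \<le> S\<^sup>2 / (2 * exp (- t - t))"
    by (simp add: divide_right_mono)
  also have "\<dots> = 2 * (exp t * S / 2)\<^sup>2"
    by (simp add: field_simps power2_eq_square mult_exp_exp flip: exp_add)
  finally have "(sinh (d / 2))\<^sup>2 \<le> (exp t * S / 2)\<^sup>2"
    by simp
  then have "sinh (d / 2) \<le> exp t * S / 2"
    by (rule power2_le_imp_le) (simp add: S0)
  moreover have "d / 2 \<le> sinh (d / 2)"
    using real_le_x_sinh[of "d / 2"] d0 by (simp add: sinh_def exp_minus)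
  ultimately show ?thesis
    by (simp add: d_def S_def)
qed

text \<open>Go up to the horosphere of height 1, across, and down again. Unlike the horizontal
  bound, this one is only linear in the depth.\<close>

lemma hyperbolic_dist_horo_le:
  assumes n: "n \<ge> 1" and t: "t \<ge> 0" "t' \<ge> 0"
  shows "hyperbolic_dist n (horo n u t) (horo n v t') \<le> t + t' + (\<Sum>i=1..<n. \<bar>u i - v i\<bar>)"
proof -
  note tri = hyperbolic_dist_triangle[OF horo_in_carrier horo_in_carrier horo_in_carrier, OF n n n n]
  have "hyperbolic_dist n (horo n u t) (horo n v t') \<le> hyperbolic_dist n (horo n u t) (horo n u 0)
      + (hyperbolic_dist n (horo n u 0) (horo n v 0) + hyperbolic_dist n (horo n v 0) (horo n v t'))"
    using tri[of u t v t' u 0] tri[of u 0 v t' v 0] by linarith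
  then show ?thesis
    using hyperbolic_dist_vertical[OF n] hyperbolic_dist_horizontal[OF n, of u 0 v] t by simp
qed

text \<open>Horizontal displacement is exponentially contracted with depth: this is what makes sets of
  polynomial growth horizontally small.\<close>

lemma hyperbolic_dist_horo_ge:
  assumes n: "n \<ge> 1" and i: "i \<in> {1..<n}" and t: "\<tau> \<le> t" "\<tau> \<le> t'" and \<rho>: "\<rho> \<ge> 0"
    and sep: "2 * exp (\<rho> - \<tau>) \<le> \<bar>u i - v i\<bar>"
  shows "\<rho> \<le> hyperbolic_dist n (horo n u t) (horo n v t')"
proof -
  have "4 * exp (2 * \<rho> - 2 * \<tau>) = (2 * exp (\<rho> - \<tau>))\<^sup>2"
    by (simp add: power2_eq_square mult_exp_exp)
  also have "\<dots> \<le> (u i - v i)\<^sup>2"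
    using power_mono[OF sep, of 2] by simp
  also have "\<dots> \<le> (\<Sum>i=1..<n. (u i - v i)\<^sup>2)"
    using i by (intro member_le_sum) auto
  also have "\<dots> \<le> (\<Sum>i=1..<n. (u i - v i)\<^sup>2) + (exp (- t) - exp (- t'))\<^sup>2"
    by simp
  finally have "4 * exp (2 * \<rho> - 2 * \<tau>) / (2 * exp (- t - t'))
      \<le> cosh (hyperbolic_dist n (horo n u t) (horo n v t')) - 1"
    unfolding cosh_dist_horo[OF n] add_diff_cancel_left' by (rule divide_right_mono) simp
  moreover have "4 * exp (2 * \<rho> - 2 * \<tau>) / (2 * exp (- t - t')) = 2 * exp (2 * \<rho> + (t - \<tau>) + (t' - \<tau>))"
    by (simp add: field_simps flip: exp_add)
  moreover have "exp \<rho> \<le> exp (2 * \<rho> + (t - \<tau>) + (t' - \<tau>))"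
    using t \<rho> by simp
  moreover have "cosh \<rho> \<le> exp \<rho>"
    using \<rho> cosh_plus_sinh[of \<rho>] by (smt (verit) sinh_real_nonneg_iff)
  ultimately have "cosh \<rho> \<le> cosh (hyperbolic_dist n (horo n u t) (horo n v t'))"
    using exp_gt_zero[of \<rho>] by linarith
  then show ?thesis
    using \<rho> hyperbolic_dist_nonneg by (simp add: cosh_real_nonneg_le_iff)
qed

section \<open>The embedding\<close>

text \<open>Picks points near prescribed levels on a chain that crosses the box sideways: the first
  point at or beyond \<tau> overshoots by at most one step.\<close>

lemma rtranclp_intermediate_value:
  fixes \<phi> :: "'b \<Rightarrow> nat"
  assumes "R\<^sup>*\<^sup>* x y" and step: "\<And>a b. R a b \<Longrightarrow> \<phi> b \<le> \<phi> a + d" and "\<phi> x \<le> \<tau>" "\<tau> \<le> \<phi> y"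
  shows "\<exists>z. R\<^sup>*\<^sup>* x z \<and> \<tau> \<le> \<phi> z \<and> \<phi> z \<le> \<tau> + d"
  using assms(1,4)
proof (induction rule: rtranclp_induct)
  case base
  then show ?case
    using assms(3) by auto
next
  case (step y z)
  show ?case
  proof (cases "\<tau> \<le> \<phi> y")
    case True
    then show ?thesis by (rule step.IH)
  next
    case False
    then have "\<phi> z \<le> \<tau> + d"
      using assms(2)[OF step.hyps(2)] by linarith
    moreover have "R\<^sup>*\<^sup>* x z"
      using step.hyps by (rule rtranclp.rtrancl_into_rtrancl)
    ultimately show ?thesis
      using step.prems by blast
  qed
qed

text \<open>Serves to choose the scale. The polynomial will be a packing bound in the Euclidean
  factor, the exponential the contraction of horizontal distances at a depth proportional to
  \<open>s\<close>. For \<open>s \<ge> 1\<close> the left side is at most \<open>C * s ^ m\<close>,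
  and \<open>x ^ m / exp x\<close> tends to 0.\<close>

lemma exp_dominates_polynomial:
  fixes a b c S \<rho> :: real
  assumes a: "a \<ge> 0" and b: "b \<ge> 0" and c: "c > 0"
  shows "\<exists>s\<ge>S. 4 * ((a * s + b) ^ m + 3) \<le> exp (c * s - \<rho>)"
proof -
  define C where "C = 4 * ((a + b) ^ m + 3)"
  have C: "C > 0"
    using a b unfolding C_def by (simp add: add_nonneg_pos)
  define \<epsilon> where "\<epsilon> = exp (- \<rho>) * c ^ m / C"
  have "\<epsilon> > 0"
    using C c by (simp add: \<epsilon>_def)
  then have "\<forall>\<^sub>F x in at_top. x ^ m / exp x < (\<epsilon> :: real)"
    by (intro order_tendstoD(2)[OF tendsto_power_div_exp_0]) auto
  then have "\<forall>\<^sub>F x in at_top. x ^ m / exp x < \<epsilon> \<and> c * S \<le> x \<and> c \<le> x"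
    by (intro eventually_conj eventually_ge_at_top)
  then obtain x where x: "x ^ m / exp x < \<epsilon>" "c * S \<le> x" "c \<le> x"
    by (metis (mono_tags, lifting) eventually_happens trivial_limit_at_top_linorder)
  define s where "s = x / c"
  have s: "S \<le> s" "1 \<le> s" and x_eq: "x = c * s"
    using x c by (simp_all add: s_def field_simps)
  have "a * s + b \<le> (a + b) * s"
    using s b mult_left_mono[of 1 s b] by (simp add: algebra_simps)
  then have "(a * s + b) ^ m \<le> ((a + b) * s) ^ m"
    using a b s by (intro power_mono) auto
  also have "\<dots> = (a + b) ^ m * s ^ m"
    by (rule power_mult_distrib)
  finally have "(a * s + b) ^ m \<le> (a + b) ^ m * s ^ m" .
  moreover have "1 \<le> s ^ m"
    using s by (simp add: one_le_power)
  ultimately have "4 * ((a * s + b) ^ m + 3) \<le> C * s ^ m"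
    unfolding C_def distrib_right distrib_left by simp
  also have "\<dots> \<le> exp (c * s - \<rho>)"
  proof -
    have "x ^ m < \<epsilon> * exp x"
      using x(1) by (simp add: field_simps)
    then have "c ^ m * (C * s ^ m) < c ^ m * (exp (- \<rho>) * exp x)"
      using C unfolding \<epsilon>_def x_eq by (simp add: field_simps power_mult_distrib)
    then show ?thesis
      using c by (simp add: x_eq mult_exp_exp)
  qed
  finally show ?thesis
    using s by blast
qed

text \<open>Upper bounds for single coordinates and a lower bound for their sum are what the
  colouring and packing arguments consume; this form keeps square roots out of them.\<close>

lemma no_coarse_embedding_coordinates:
  fixes n m :: nat and T :: "nat \<Rightarrow> 'a metric" and L l :: real
    and F :: "(nat \<Rightarrow> real) \<Rightarrow> nat \<Rightarrow> 'a" and G :: "(nat \<Rightarrow> real) \<Rightarrow> nat \<Rightarrow> real"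
  assumes n: "n \<ge> 2" and T: "\<And>i. i \<in> {1..n - 1} \<Longrightarrow> metric_tree (T i)"
    and L: "L \<ge> 1" and l: "l \<ge> 0"
    and F: "\<And>x. x \<in> hyperbolic_carrier n \<Longrightarrow> F x \<in> (\<Pi>\<^sub>E i\<in>{1..n - 1}. mspace (T i))"
    and F_le: "\<And>x y i. \<lbrakk>x \<in> hyperbolic_carrier n; y \<in> hyperbolic_carrier n; i \<in> {1..n - 1}\<rbrakk> \<Longrightarrow>
      mdist (T i) (F x i) (F y i) \<le> L * hyperbolic_dist n x y + l"
    and G_le: "\<And>x y j. \<lbrakk>x \<in> hyperbolic_carrier n; y \<in> hyperbolic_carrier n; j \<in> {1..m}\<rbrakk> \<Longrightarrow>
      \<bar>G x j - G y j\<bar> \<le> L * hyperbolic_dist n x y + l"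
    and ge: "\<And>x y. \<lbrakk>x \<in> hyperbolic_carrier n; y \<in> hyperbolic_carrier n\<rbrakk> \<Longrightarrow>
      hyperbolic_dist n x y / L - l \<le>
        (\<Sum>i=1..n - 1. mdist (T i) (F x i) (F y i)) + (\<Sum>j=1..m. \<bar>G x j - G y j\<bar>)"
  shows False
proof -
  let ?H = "hyperbolic_carrier n" and ?d = "hyperbolic_dist n"
  have n1: "n \<ge> 1"
    using n by simp
  note H = horo_in_carrier[OF n1]
  \<comment> \<open>Where the tree coordinates vary by at most \<beta>, the lower bound has to be
    met by \<open>G\<close>. What remains of it is at least \<delta>, so
    \<open>card_separated_le\<close> limits the number of \<rho>-separated points.\<close>
  have packing: "card J \<le> (2 * (L * r + l) * (real m + 1) / \<delta> + 2) ^ m"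
    if J: "finite J" and X: "\<And>a. a \<in> J \<Longrightarrow> X a \<in> ?H" and r: "r \<ge> 0" and \<delta>: "\<delta> > 0"
      and diam: "\<And>a b. \<lbrakk>a \<in> J; b \<in> J\<rbrakk> \<Longrightarrow> ?d (X a) (X b) \<le> r"
      and sep: "\<And>a b. \<lbrakk>a \<in> J; b \<in> J; a \<noteq> b\<rbrakk> \<Longrightarrow> \<rho> \<le> ?d (X a) (X b)"
      and fibre: "\<And>a b i. \<lbrakk>a \<in> J; b \<in> J; i \<in> {1..n - 1}\<rbrakk> \<Longrightarrow> mdist (T i) (F (X a) i) (F (X b) i) \<le> \<beta>"
      and \<rho>: "\<delta> \<le> \<rho> / L - l - real (n - 1) * \<beta>"
    for J :: "nat set" and X r \<delta> \<rho> \<beta>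
  proof (rule card_separated_le[OF J \<delta>, of _ m "\<lambda>a. G (X a)"])
    show "0 \<le> L * r + l"
      using L l r by simp
  next
    fix a b j assume *: "a \<in> J" "b \<in> J" "j \<in> {1..m}"
    have "L * ?d (X a) (X b) \<le> L * r"
      using L diam[OF *(1,2)] by (intro mult_left_mono) auto
    then show "\<bar>G (X a) j - G (X b) j\<bar> \<le> L * r + l"
      using G_le[OF X[OF *(1)] X[OF *(2)] *(3)] by linarith
  next
    fix a b assume *: "a \<in> J" "b \<in> J" "a \<noteq> b"
    have "\<rho> / L \<le> ?d (X a) (X b) / L"
      using L sep[OF *] by (intro divide_right_mono) auto
    moreover have "(\<Sum>i=1..n - 1. mdist (T i) (F (X a) i) (F (X b) i)) \<le> (\<Sum>i=1..n - 1. \<beta>)"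
      using fibre * by (intro sum_mono) auto
    ultimately show "\<delta> \<le> (\<Sum>j=1..m. \<bar>G (X a) j - G (X b) j\<bar>)"
      using ge[OF X[OF *(1)] X[OF *(2)]] \<rho> by simp
  qed
  \<comment> \<open>\<open>g\<close> exceeds the change of a tree coordinate over distance 1, and
    \<open>B\<close> bounds the resulting diameter of a monochromatic chain.
    \<open>K\<^sub>0\<close> bounds the first packing uniformly in \<open>s\<close>, and
    \<open>M\<close> the horizontal extent of all slabs together. Separation \<rho> leaves at least
    1 for \<open>G\<close> after subtracting \<open>l\<close> and tree coordinates that vary by
    \<open>2 * B\<close>.\<close>
  define g where "g = L + l + 1"
  define B where "B = 2 * n * g"
  define K\<^sub>0 where "K\<^sub>0 = (2 * (6 * n * L\<^sup>2 + 1) * (real m + 1) + 2) ^ m"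
  define N\<^sub>0 where "N\<^sub>0 = nat \<lceil>K\<^sub>0\<rceil>"
  define M :: real where "M = 3 * N\<^sub>0 + 1 + n"
  define \<rho> where "\<rho> = L * (l + 2 * n * B + 1)"
  have g: "g > 0" and B0: "B \<ge> 0" and M0: "M \<ge> 0" and \<rho>0: "\<rho> \<ge> 0"
    using L l by (simp_all add: g_def B_def M_def \<rho>_def)
  \<comment> \<open>The linear condition will exclude a chain from top to bottom, the exponential
    one a chain between vertical faces.\<close>
  obtain s where s_ge: "s \<ge> l + 1 + M + 2 * (B + 2 * L + 2 * l + L * M)"
    and s_exp: "4 * ((12 * n * L\<^sup>2 * (real m + 1) * s + (2 * l * (real m + 1) + 2)) ^ m + 3) \<le> exp (1 / (4 * L) * s - \<rho>)"
    using exp_dominates_polynomial[of "12 * n * L\<^sup>2 * (real m + 1)" "2 * l * (real m + 1) + 2" "1 / (4 * L)"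
        "l + 1 + M + 2 * (B + 2 * L + 2 * l + L * M)" m \<rho>] L l by auto
  \<comment> \<open>The bottom \<open>k\<close> is so deep that points \<open>k\<close> apart whose
    tree coordinates vary by at most \<open>2 * s\<close> still have Euclidean parts
    \<open>s\<close> apart. The top \<open>s'\<close> is so shallow that descending to it moves a
    tree coordinate by at most \<open>s / 4 + l\<close>.\<close>
  define k where "k = 2 * n * L * s"
  define s' where "s' = s / (4 * L)"
  have s0: "s \<ge> 0" "s \<ge> 1" "s \<ge> l" "s \<ge> M"
    using s_ge l L B0 M0 by (simp_all add: add_nonneg_nonneg) (smt (verit) mult_nonneg_nonneg)+
  have s'0: "s' \<ge> 0"
    using s0 L by (simp add: s'_def)
  have "1 * s \<le> L * s" "1 * (L * s) \<le> real n * (L * s)"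
    using L s0 n by (intro mult_right_mono; simp)+
  then have ks: "s \<le> k"
    using s0 unfolding k_def mult.assoc by linarith
  have s'_le: "s' \<le> s" and Ls': "L * s' = s / 4"
    using L s0 mult_mono[of 1 "4 * L" s s] by (simp_all add: s'_def field_simps)
  define o' where "o' = horo n (\<lambda>_. 0) 0"

  text \<open>The packing bound at depth \<open>k\<close> does not depend on \<open>s\<close>, so one of \<open>N\<^sub>0 + 1\<close> disjoint slabs
    consists of points whose tree coordinates have left the \<open>s\<close>-ball around those of \<open>o'\<close>.\<close>

  define slab where "slab = (\<lambda>a u. u 1 \<in> {3 * real a..3 * real a + 1} \<and> (\<forall>i\<in>{2..<n}. u i \<in> {0..1}))"
  have "\<exists>a\<le>N\<^sub>0. \<forall>u. slab a u \<longrightarrow>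
      (\<exists>i\<in>{1..n - 1}. s < mdist (T i) (F (horo n u k) i) (F o' i))"
  proof (rule ccontr)
    assume "\<not> ?thesis"
    then have "\<forall>a. \<exists>u. a \<le> N\<^sub>0 \<longrightarrow> slab a u \<and>
        (\<forall>i\<in>{1..n - 1}. mdist (T i) (F (horo n u k) i) (F o' i) \<le> s)"
      by (metis not_less)
    then obtain u where u': "\<And>a. a \<le> N\<^sub>0 \<Longrightarrow> slab a (u a) \<and>
        (\<forall>i\<in>{1..n - 1}. mdist (T i) (F (horo n (u a) k) i) (F o' i) \<le> s)"
      by metis
    have u: "u a 1 \<in> {3 * real a..3 * real a + 1}" "\<And>i. i \<in> {2..<n} \<Longrightarrow> u a i \<in> {0..1}"
        "\<And>i. i \<in> {1..n - 1} \<Longrightarrow> mdist (T i) (F (horo n (u a) k) i) (F o' i) \<le> s" if "a \<le> N\<^sub>0" for a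
      using u'[OF that] by (simp_all add: slab_def)
    have "card {..N\<^sub>0} \<le> (2 * (L * (3 * k) + l) * (real m + 1) / s + 2) ^ m"
    proof (rule packing[where X = "\<lambda>a. horo n (u a) k" and \<rho> = k and \<beta> = "2 * s"])
      fix a b assume ab: "a \<in> {..N\<^sub>0}" "b \<in> {..N\<^sub>0}"
      have "(\<Sum>i=1..<n. \<bar>u a i - u b i\<bar>) \<le> (\<Sum>i=1..<n. (if i = 1 then 3 * real N\<^sub>0 + 1 else 0) + 1)"
      proof (rule sum_mono)
        fix i assume i: "i \<in> {1..<n}"
        show "\<bar>u a i - u b i\<bar> \<le> (if i = 1 then 3 * real N\<^sub>0 + 1 else 0) + 1"
        proof (cases "i = 1")
          case True
          then show ?thesis
            using u(1)[of a] u(1)[of b] ab by auto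
        next
          case False
          then show ?thesis
            using u(2)[of a i] u(2)[of b i] ab i by auto
        qed
      qed
      also have "\<dots> \<le> M"
        using n by (simp add: M_def sum.distrib of_nat_diff)
      finally show "?d (horo n (u a) k) (horo n (u b) k) \<le> 3 * k"
        using hyperbolic_dist_horo_le[OF n1, of k k "u a" "u b"] ks s0 by linarith
      fix i assume i: "i \<in> {1..n - 1}"
      have "F (horo n (u c) k) i \<in> mspace (T i)" "F o' i \<in> mspace (T i)" for c
        using F[OF H] i unfolding o'_def by blast+
      then show "mdist (T i) (F (horo n (u a) k) i) (F (horo n (u b) k) i) \<le> 2 * s"
        using u(3)[of a i] u(3)[of b i] ab i
          mdist_triangle[of "F (horo n (u a) k) i" "T i" "F o' i" "F (horo n (u b) k) i"]
        by (simp add: mdist_commute)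
    next
      fix a b :: nat assume ab: "a \<in> {..N\<^sub>0}" "b \<in> {..N\<^sub>0}" "a \<noteq> b"
      \<comment> \<open>Slabs have width 1 and start 3 apart, and \<open>2 = 2 * exp (k - k)\<close>
        is the displacement that guarantees distance \<open>k\<close> at depth
        \<open>k\<close>.\<close>
      then have "2 \<le> \<bar>u a 1 - u b 1\<bar>"
        using u(1)[of a] u(1)[of b] by (cases "a < b") auto
      then show "k \<le> ?d (horo n (u a) k) (horo n (u b) k)"
        using n ks s0 by (intro hyperbolic_dist_horo_ge[OF n1, where i = 1 and \<tau> = k]) auto
    next
      have "k / L = 2 * n * s"
        using L by (simp add: k_def)
      moreover have "real (n - 1) * (2 * s) = 2 * n * s - 2 * s"
        using n by (simp add: of_nat_diff algebra_simps)
      ultimately show "s \<le> k / L - l - real (n - 1) * (2 * s)"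
        using s0 by linarith
    qed (use H ks s0 in auto)
    also have "\<dots> \<le> K\<^sub>0"
      unfolding K\<^sub>0_def
    proof (intro power_mono add_right_mono)
      have "L * (3 * k) + l \<le> (6 * n * L\<^sup>2 + 1) * s"
        using s0 by (simp add: k_def algebra_simps power2_eq_square)
      then have "2 * (L * (3 * k) + l) * (real m + 1) \<le> 2 * ((6 * n * L\<^sup>2 + 1) * s) * (real m + 1)"
        by (intro mult_right_mono mult_left_mono) auto
      then show "2 * (L * (3 * k) + l) * (real m + 1) / s \<le> 2 * (6 * n * L\<^sup>2 + 1) * (real m + 1)"
        using s0 by (simp add: pos_divide_le_eq mult_ac)
    qed (use L l ks s0 in simp)
    finally show False
      unfolding N\<^sub>0_def by simp linarith
  qed
  then obtain a where a: "a \<le> N\<^sub>0" and far: "\<And>u. slab a u \<Longrightarrow>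
      \<exists>i\<in>{1..n - 1}. s < mdist (T i) (F (horo n u k) i) (F o' i)"
    by blast

  \<comment> \<open>\<open>N\<close> is a packing bound rounded up, to be contradicted by
    \<open>N + 1\<close> points on levels \<open>q\<close> apart; \<open>N + 2\<close> multiples of
    \<open>q\<close> leave room for overshoot. \<open>q\<close> is so large that a grid step has
    length at most 1 even at depth \<open>k\<close>, where horizontal lengths are multiplied by
    \<open>exp k\<close>.\<close>
  define N where "N = nat \<lceil>(2 * (L * (3 * k) + l) * (real m + 1) / 1 + 2) ^ m\<rceil>"
  define q where "q = nat \<lceil>4 * n * exp k + 4 * k + 4\<rceil>"
  define p where "p = q * (N + 2)"
  have q_ge: "real q \<ge> 4 * n * exp k" "real q \<ge> 4 * k" "q \<ge> 4"
  proof -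
    have "real q \<ge> 4 * n * exp k + 4 * k + 4"
      unfolding q_def by (rule real_nat_ceiling_ge)
    moreover have "4 * n * exp k \<ge> 0" "4 * k \<ge> 0"
      using ks s0 by simp_all
    ultimately show "real q \<ge> 4 * n * exp k" "real q \<ge> 4 * k" "q \<ge> 4"
      by linarith+
  qed
  have pq: "p \<ge> q"
    by (simp add: p_def)
  have p: "p > 0" "real p \<ge> 4 * n * exp k" "real p \<ge> 4 * k"
    using q_ge pq by (auto intro: order_trans)

  define base where "base = (\<lambda>i :: nat. if i = 1 then 3 * real a else 0)"
  \<comment> \<open>Grid coordinate 0 is the depth, running from \<open>s'\<close> to
    \<open>k\<close>; the others sweep the chosen unit cube.\<close>
  define u where "u = (\<lambda>(x :: nat \<Rightarrow> nat) i. base i + real (x i) / p)"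
  define t where "t = (\<lambda>x :: nat \<Rightarrow> nat. s' + (k - s') * (real (x 0) / p))"
  define pt where "pt = (\<lambda>x. horo n (u x) (t x))"
  have pt: "pt x \<in> ?H" for x
    unfolding pt_def by (rule H)
  have t: "s' \<le> t x" "t x \<le> k" if "x 0 \<le> p" for x
  proof -
    have "0 \<le> real (x 0) / p" "real (x 0) / p \<le> 1"
      using that p by simp_all
    then have "0 \<le> (k - s') * (real (x 0) / p)" "(k - s') * (real (x 0) / p) \<le> k - s'"
      using ks s'_le by (simp_all only: mult_nonneg_nonneg mult_left_le diff_ge_0_iff_ge order_trans)
    then show "s' \<le> t x" "t x \<le> k"
      unfolding t_def by simp_all
  qed
  have step: "?d (pt x) (pt y) \<le> 1"
    if *: "\<And>j. j < n \<Longrightarrow> x j \<le> p \<and> y j \<le> p \<and> x j \<le> y j + 2 \<and> y j \<le> x j + 2" for x y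
  proof -
    have diff: "\<bar>real (x j) / p - real (y j) / p\<bar> \<le> 2 / p" if "j < n" for j
    proof -
      have "\<bar>real (x j) - real (y j)\<bar> \<le> 2"
        using *[OF that] by linarith
      then show ?thesis
        using p by (simp add: divide_right_mono flip: diff_divide_distrib)
    qed
    have "t x - t y = (k - s') * (real (x 0) / p - real (y 0) / p)"
      unfolding t_def right_diff_distrib by simp
    then have "\<bar>t x - t y\<bar> = (k - s') * \<bar>real (x 0) / p - real (y 0) / p\<bar>"
      using ks s'_le by (simp add: abs_mult)
    also have "\<dots> \<le> k * (2 / p)"
      using diff[of 0] n ks s'_le s'0 by (intro mult_mono) auto
    also have "\<dots> \<le> 1 / 2"
      using p by (simp add: field_simps)
    finally have v: "\<bar>t x - t y\<bar> \<le> 1 / 2" .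
    have "(\<Sum>i=1..<n. \<bar>u x i - u y i\<bar>) \<le> (\<Sum>i=1..<n. 2 / p)"
      using diff by (intro sum_mono) (simp add: u_def)
    also have "\<dots> \<le> n * (2 / p)"
      by (simp add: divide_right_mono)
    finally have "exp (t y) * (\<Sum>i=1..<n. \<bar>u x i - u y i\<bar>) \<le> exp k * (n * (2 / p))"
      using t(2)[of y] *[of 0] n by (intro mult_mono) (auto simp: sum_nonneg)
    also have "\<dots> \<le> 1 / 2"
      using p by (simp add: field_simps)
    finally have h: "?d (horo n (u x) (t y)) (horo n (u y) (t y)) \<le> 1 / 2"
      using hyperbolic_dist_horizontal[OF n1, of "u x" "t y" "u y"] by linarith
    have "?d (pt x) (pt y) \<le> ?d (pt x) (horo n (u x) (t y)) + ?d (horo n (u x) (t y)) (pt y)"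
      by (rule hyperbolic_dist_triangle[OF pt H pt n1])
    with v h show ?thesis
      using hyperbolic_dist_vertical[OF n1, of "u x" "t x" "t y"] by (simp add: pt_def)
  qed
  obtain col where col: "\<And>x. col x < n"
    and col_diam: "\<And>c x y. (\<lambda>x y. x \<in> (\<Pi>\<^sub>E i\<in>{1..n - 1}. mspace (T i)) \<and> y \<in> (\<Pi>\<^sub>E i\<in>{1..n - 1}. mspace (T i)) \<and>
            col x = c \<and> col y = c \<and> (\<forall>i\<in>{1..n - 1}. mdist (T i) (x i) (y i) < g))\<^sup>*\<^sup>* x y
         \<Longrightarrow> x \<in> (\<Pi>\<^sub>E i\<in>{1..n - 1}. mspace (T i))
         \<Longrightarrow> \<forall>i\<in>{1..n - 1}. mdist (T i) (x i) (y i) \<le> 2 * n * g"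
  proof (rule tree_product_coloring[OF T _ n1 g])
    fix i assume "i \<in> {1..n - 1}"
    then show "mspace (T i) \<noteq> {}"
      using F[OF pt] by blast
  qed (use that in blast)+
  define R where "R = (\<lambda>i x y. (\<forall>j<n. x j \<le> p \<and> y j \<le> p \<and> x j \<le> y j + 2 \<and> y j \<le> x j + 2) \<and>
    col (F (pt x)) = i \<and> col (F (pt y)) = i)"
  have chain: "mdist (T i) (F (pt x) i) (F (pt y) i) \<le> B"
    if "(R c)\<^sup>*\<^sup>* x y" "i \<in> {1..n - 1}" for c x y i
  proof -
    define E where "E = (\<lambda>x y. x \<in> (\<Pi>\<^sub>E i\<in>{1..n - 1}. mspace (T i)) \<and> y \<in> (\<Pi>\<^sub>E i\<in>{1..n - 1}. mspace (T i)) \<and>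
            col x = c \<and> col y = c \<and> (\<forall>i\<in>{1..n - 1}. mdist (T i) (x i) (y i) < g))"
    have "E (F (pt y)) (F (pt z))" if R: "R c y z" for y z
    proof -
      have "?d (pt y) (pt z) \<le> 1"
        using R by (intro step) (simp add: R_def)
      then have "L * ?d (pt y) (pt z) \<le> L"
        using L by (simp add: mult_left_le)
      then have "mdist (T i) (F (pt y) i) (F (pt z) i) < g" if "i \<in> {1..n - 1}" for i
        using F_le[OF pt pt that, of y z] by (simp add: g_def)
      then show ?thesis
        using R F[OF pt] unfolding E_def R_def by blast
    qed
    with that(1) have "E\<^sup>*\<^sup>* (F (pt x)) (F (pt y))"
      by (induction rule: rtranclp_induct) (auto intro: rtranclp.rtrancl_into_rtrancl)
    then show ?thesis
      using col_diam[of c "F (pt x)" "F (pt y)"] F[OF pt] that(2) unfolding E_def B_def by blast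
  qed
  \<comment> \<open>The crossing is in the direction that bears the number of its colour: depth for
    0, horizontal for the others.\<close>
  obtain c x y where c: "c < n" and x: "\<And>j. j < n \<Longrightarrow> x j \<le> p" "x c \<le> 1"
    and y: "p \<le> y c + 1" and xy: "(R c)\<^sup>*\<^sup>* x y"
    using hex_chain[OF p(1), of n "\<lambda>x. col (F (pt x))"] col unfolding R_def by blast
  have grid: "z j \<le> p" if "(R c)\<^sup>*\<^sup>* x z" "j < n" for z j
    using that by (induction rule: rtranclp_induct) (use x in \<open>auto simp: R_def\<close>)
  show False
  proof (cases "c = 0")
    case True
    have "t x \<le> s' + k * (1 / p)"
      unfolding t_def using x(2) True ks s'_le s'0 p(1)
      by (intro add_left_mono mult_mono divide_right_mono) auto
    also have "k * (1 / p) \<le> 1"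
      using p ks s0 by (simp add: field_simps)
    finally have tx: "t x \<le> s' + 1"
      by simp
    have "(\<Sum>i=1..<n. \<bar>u x i - 0\<bar>) \<le> (\<Sum>i=1..<n. (if i = 1 then 3 * real a else 0) + 1)"
      using x(1) p(1) by (intro sum_mono) (auto simp: u_def base_def)
    also have "\<dots> \<le> M"
      using n a by (simp add: M_def sum.distrib of_nat_diff)
    finally have "?d (pt x) o' \<le> s' + 1 + M"
      using hyperbolic_dist_horo_le[OF n1, of "t x" 0 "u x" "\<lambda>_. 0"] tx t(1)[of x] x(1)[of 0] n s'0
      unfolding pt_def o'_def by simp
    then have "L * ?d (pt x) o' \<le> s / 4 + L + L * M"
      using L mult_left_mono[of "?d (pt x) o'" "s' + 1 + M" L] by (simp add: algebra_simps Ls')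
    then have start: "mdist (T i) (F (pt x) i) (F o' i) \<le> s / 4 + L + L * M + l" if "i \<in> {1..n - 1}" for i
      using F_le[OF pt H that, of x "\<lambda>_. 0" 0] unfolding o'_def by linarith
    \<comment> \<open>\<open>y\<close> is at most one grid layer above the bottom. Moving it to
      depth \<open>k\<close> exactly, where \<open>far\<close> applies, changes each tree coordinate
      by at most \<open>L + l\<close>.\<close>
    define y' where "y' = horo n (u y) k"
    have y_le: "y j \<le> p" if "j < n" for j
      using grid[OF xy that] .
    have "\<bar>t y - k\<bar> = (k - s') * (1 - real (y 0) / p)"
      using t(2)[of y] y_le[of 0] n unfolding t_def by (simp add: algebra_simps)
    also have "\<dots> \<le> k * (1 / p)"
    proof (rule mult_mono)
      have "real p - real (y 0) \<le> 1"
        using y True by simp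
      then have "(real p - real (y 0)) / p \<le> 1 / p"
        by (rule divide_right_mono) simp
      then show "1 - real (y 0) / p \<le> 1 / p"
        using p(1) by (simp add: diff_divide_distrib)
      show "0 \<le> 1 - real (y 0) / p"
        using p(1) y_le[of 0] n by simp
    qed (use ks s'0 s0 in auto)
    also have "\<dots> \<le> 1"
      using p ks s0 by (simp add: field_simps)
    finally have "?d (pt y) y' \<le> 1"
      using hyperbolic_dist_vertical[OF n1, of "u y" "t y" k] by (simp add: pt_def y'_def)
    then have Ld: "L * ?d (pt y) y' \<le> L"
      using L by (simp add: mult_left_le)
    have "\<exists>i\<in>{1..n - 1}. s < mdist (T i) (F y' i) (F o' i)"
      unfolding y'_def
    proof (rule far)
      have "u y 1 \<in> {3 * real a..3 * real a + 1}"
        using y_le[of 1] n p(1) by (simp add: u_def base_def)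
      moreover have "u y i \<in> {0..1}" if "i \<in> {2..<n}" for i
        using y_le[of i] that p(1) by (simp add: u_def base_def)
      ultimately show "slab a (u y)"
        by (simp add: slab_def)
    qed
    then obtain i where i: "i \<in> {1..n - 1}" and si: "s < mdist (T i) (F y' i) (F o' i)"
      by blast
    have mem: "F (pt x) i \<in> mspace (T i)" "F (pt y) i \<in> mspace (T i)" "F y' i \<in> mspace (T i)"
        "F o' i \<in> mspace (T i)"
      using F[OF pt] F[OF H] i unfolding y'_def o'_def by blast+
    have "mdist (T i) (F y' i) (F o' i) \<le> mdist (T i) (F (pt y) i) (F y' i)
        + (mdist (T i) (F (pt x) i) (F (pt y) i) + mdist (T i) (F (pt x) i) (F o' i))"
      using mdist_triangle[OF mem(3,2,4)] mdist_triangle[OF mem(2,1,4)] by (simp add: mdist_commute)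
    moreover have "mdist (T i) (F (pt y) i) (F y' i) \<le> L + l"
      using F_le[OF pt H i, of y "u y" k] Ld unfolding y'_def by linarith
    moreover have "mdist (T i) (F (pt x) i) (F (pt y) i) \<le> B"
      by (rule chain[OF xy i])
    moreover have "mdist (T i) (F (pt x) i) (F o' i) \<le> s / 4 + L + L * M + l"
      by (rule start[OF i])
    moreover have "L * M \<ge> 0"
      using L M0 by simp
    \<comment> \<open>\<open>V\<close> collects the terms that do not depend on \<open>s\<close>.
      Since \<open>s\<close> is at least \<open>2 * V\<close>, it cannot be less than
      \<open>s / 4 + V\<close>.\<close>
    moreover define V where "V = B + 2 * L + 2 * l + L * M"
    ultimately have "s < s / 4 + V" "V \<ge> 0"
      using si l L B0 by simp_all
    then show False
      using s_ge l M0 unfolding V_def[symmetric] by simp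
  next
    case False
    then have c': "c \<in> {1..<n}"
      using c by simp
    \<comment> \<open>The levels are offset by 1 because \<open>x c\<close> may be 1, and a step of
      \<open>R\<close> can overshoot by 2.\<close>
    have "\<exists>z. (R c)\<^sup>*\<^sup>* x z \<and> 1 + b * q \<le> z c \<and> z c \<le> 1 + b * q + 2" if "b \<le> N" for b
    proof (rule rtranclp_intermediate_value[OF xy])
      have "b * q \<le> N * q"
        using that by simp
      moreover have "p = N * q + 2 * q"
        by (simp add: p_def algebra_simps)
      ultimately show "1 + b * q \<le> y c"
        using y q_ge(3) by linarith
    qed (use x(2) c in \<open>auto simp: R_def\<close>)
    then obtain z where z: "\<And>b. b \<le> N \<Longrightarrow> (R c)\<^sup>*\<^sup>* x (z b)"
        "\<And>b. b \<le> N \<Longrightarrow> 1 + b * q \<le> z b c" "\<And>b. b \<le> N \<Longrightarrow> z b c \<le> 1 + b * q + 2"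
      by metis
    have zt: "s' \<le> t (z b)" "t (z b) \<le> k" if "b \<le> N" for b
      using t[of "z b"] grid[OF z(1)[OF that], of 0] n by simp_all
    \<comment> \<open>Identifies the packing bound with the polynomial for which \<open>s\<close>
      was chosen.\<close>
    have kL: "2 * (L * (3 * k) + l) * (real m + 1) / 1 + 2
        = 12 * n * L\<^sup>2 * (real m + 1) * s + (2 * l * (real m + 1) + 2)"
      by (simp add: k_def algebra_simps power2_eq_square)
    define K where "K = (2 * (L * (3 * k) + l) * (real m + 1) / 1 + 2) ^ m"
    have K0: "K \<ge> 0"
      unfolding K_def using L l ks s0 by (intro zero_le_power) simp
    have KN: "K \<le> N" "N \<le> K + 1"
      using K0 unfolding N_def K_def[symmetric] by linarith+
    have "4 * (real N + 2) \<le> 4 * (K + 3)"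
      using KN by simp
    also have "\<dots> \<le> exp (s' - \<rho>)"
      using s_exp unfolding K_def kL s'_def by simp
    finally have N_exp: "4 * (real N + 2) * exp (\<rho> - s') \<le> 1"
      by (simp add: exp_diff field_simps)
    \<comment> \<open>On the chain all tree coordinates are within \<open>B\<close> of those at
      \<open>pt x\<close>, so within \<open>2 * B\<close> of each other, and packing applies with
      \<delta> equal to 1. There are \<open>N + 1\<close> points, but the bound is at most
      \<open>N\<close>.\<close>
    have "card {..N} \<le> (2 * (L * (3 * k) + l) * (real m + 1) / 1 + 2) ^ m"
    proof (rule packing[where X = "\<lambda>b. pt (z b)" and \<rho> = \<rho> and \<beta> = "2 * B"])
      fix b b' assume b: "b \<in> {..N}" "b' \<in> {..N}"
      have "\<bar>u (z b) i - u (z b') i\<bar> \<le> 1" if "i \<in> {1..<n}" for i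
      proof -
        have "real (z b i) / p \<in> {0..1}" "real (z b' i) / p \<in> {0..1}"
          using grid[OF z(1), of b i] grid[OF z(1), of b' i] b that p(1) by simp_all
        then show ?thesis
          unfolding u_def atLeastAtMost_iff abs_le_iff by linarith
      qed
      then have "(\<Sum>i=1..<n. \<bar>u (z b) i - u (z b') i\<bar>) \<le> (\<Sum>i=1..<n. 1)"
        by (rule sum_mono)
      also have "\<dots> \<le> M"
        by (simp add: M_def)
      finally show "?d (pt (z b)) (pt (z b')) \<le> 3 * k"
        using hyperbolic_dist_horo_le[OF n1, of "t (z b)" "t (z b')" "u (z b)" "u (z b')"]
          zt[of b] zt[of b'] b ks s0 s'0 unfolding pt_def by simp
      fix i assume i: "i \<in> {1..n - 1}"
      have "F (pt w) i \<in> mspace (T i)" for w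
        using F[OF pt] i by blast
      then show "mdist (T i) (F (pt (z b)) i) (F (pt (z b')) i) \<le> 2 * B"
        using chain[OF z(1) i, of b] chain[OF z(1) i, of b'] b
          mdist_triangle[of "F (pt (z b)) i" "T i" "F (pt x) i" "F (pt (z b')) i"]
        by (simp add: mdist_commute)
    next
      \<comment> \<open>Different levels lie at least \<open>q - 2 \<ge> q / 2\<close> grid units
        apart, which is \<open>1 / (2 * (N + 2))\<close> after division by \<open>p\<close>. This
        decays polynomially in \<open>s\<close>, the displacement needed at depth \<open>s'\<close>
        exponentially.\<close>
      have sep: "2 * exp (\<rho> - s') \<le> \<bar>u (z b) c - u (z b') c\<bar>" if b: "b' \<le> N" "b < b'" for b b'
      proof -
        have "(b + 1) * q \<le> b' * q"
          using b by (intro mult_right_mono) auto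
        then have "z b c + q \<le> z b' c + 2"
          using z(3)[of b] z(2)[of b'] b by (simp add: algebra_simps)
        then have "real q / 2 \<le> real (z b' c) - real (z b c)"
          using q_ge(3) by linarith
        then have "real q / 2 / p \<le> (real (z b' c) - real (z b c)) / p"
          by (rule divide_right_mono) simp
        moreover have "real q / 2 / p = 1 / (2 * (real N + 2))"
        proof -
          have "real q / 2 / (real q * w) = 1 / (2 * w)" for w
            using q_ge(3) by simp
          then show ?thesis
            by (simp only: p_def of_nat_mult of_nat_add of_nat_numeral)
        qed
        moreover have "2 * exp (\<rho> - s') \<le> 1 / (2 * (real N + 2))"
          using N_exp by (simp add: field_simps)
        ultimately show ?thesis
          by (simp add: u_def diff_divide_distrib)
      qed
      fix b b' :: nat assume b: "b \<in> {..N}" "b' \<in> {..N}" "b \<noteq> b'"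
      have "2 * exp (\<rho> - s') \<le> \<bar>u (z b) c - u (z b') c\<bar>"
        using sep[of b' b] sep[of b b'] b by (cases "b < b'") (auto simp: abs_minus_commute)
      then show "\<rho> \<le> ?d (pt (z b)) (pt (z b'))"
        unfolding pt_def using zt b by (intro hyperbolic_dist_horo_ge[OF n1 c' _ _ \<rho>0]) auto
    next
      have "\<rho> / L = l + 2 * n * B + 1"
        using L by (simp add: \<rho>_def)
      moreover have "real (n - 1) * (2 * B) \<le> 2 * n * B"
        using n B0 by (simp add: of_nat_diff algebra_simps)
      ultimately show "1 \<le> \<rho> / L - l - real (n - 1) * (2 * B)"
        by linarith
    qed (use pt ks s0 in auto)
    then show False
      using KN unfolding K_def[symmetric] by simp
  qed
qed

theorem corollary1p2:
  fixes n m :: nat and T :: "nat \<Rightarrow> 'a metric"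
  assumes "n \<ge> 2"
    and "\<And>i. i \<in> {1..n - 1} \<Longrightarrow> metric_tree (T i)"
  shows "\<nexists>f. quasi_isometric_embedding (hyperbolic_metric n)
           (prod_metric (l2_product_metric {1..n - 1} T) (Euclidean_metric m)) f"
proof (rule notI, elim exE)
  let ?P = "\<Pi>\<^sub>E i\<in>{1..n - 1}. mspace (T i)"
  fix f
  assume "quasi_isometric_embedding (hyperbolic_metric n)
           (prod_metric (l2_product_metric {1..n - 1} T) (Euclidean_metric m)) f"
  then obtain L l where f: "f \<in> hyperbolic_carrier n \<rightarrow> ?P \<times> mspace (Euclidean_metric m)"
    and L: "L \<ge> 1" and l: "l \<ge> 0"
    and qi: "\<And>x y. \<lbrakk>x \<in> hyperbolic_carrier n; y \<in> hyperbolic_carrier n\<rbrakk> \<Longrightarrow>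
        1 / L * hyperbolic_dist n x y - l \<le>
          prod_dist (mdist (l2_product_metric {1..n - 1} T)) (mdist (Euclidean_metric m)) (f x) (f y) \<and>
        prod_dist (mdist (l2_product_metric {1..n - 1} T)) (mdist (Euclidean_metric m)) (f x) (f y)
          \<le> L * hyperbolic_dist n x y + l"
    using assms(1) unfolding quasi_isometric_embedding_def by auto
  define F where "F = (\<lambda>x. fst (f x))"
  define G where "G = (\<lambda>x. snd (f x))"
  define DF where "DF = (\<lambda>x y. L2_set (\<lambda>i. mdist (T i) (F x i) (F y i)) {1..n - 1})"
  \<comment> \<open>Absolute values do not change the norm and make the entries nonnegative, so that
    each entry bounds it from below and their sum from above.\<close>
  define DG where "DG = (\<lambda>x y. L2_set (\<lambda>j. \<bar>G x j - G y j\<bar>) {1..m})"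
  have DG: "mdist (Euclidean_metric m) (G x) (G y) = DG x y" for x y
    by (simp add: DG_def L2_set_def)
  have prod: "prod_dist (mdist (l2_product_metric {1..n - 1} T)) (mdist (Euclidean_metric m)) (f x) (f y)
      = sqrt ((DF x y)\<^sup>2 + (DG x y)\<^sup>2)" for x y
    unfolding DG[symmetric] by (simp add: prod_dist_def case_prod_unfold F_def G_def DF_def)
  have nonneg: "DF x y \<ge> 0" "DG x y \<ge> 0" for x y
    by (simp_all add: DF_def DG_def)
  show False
  proof (rule no_coarse_embedding_coordinates[where F = F and G = G and m = m, OF assms L l])
    show "F x \<in> ?P" if "x \<in> hyperbolic_carrier n" for x
      using f that by (auto simp: F_def Pi_iff mem_Times_iff)
  next
    fix x y i assume xy: "x \<in> hyperbolic_carrier n" "y \<in> hyperbolic_carrier n" and i: "i \<in> {1..n - 1}"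
    have "mdist (T i) (F x i) (F y i) \<le> DF x y"
      unfolding DF_def by (rule member_le_L2_set) (use i in auto)
    also have "\<dots> \<le> sqrt ((DF x y)\<^sup>2 + (DG x y)\<^sup>2)"
      by (rule real_sqrt_sum_squares_ge1)
    finally show "mdist (T i) (F x i) (F y i) \<le> L * hyperbolic_dist n x y + l"
      using qi[OF xy] unfolding prod by linarith
  next
    fix x y j assume xy: "x \<in> hyperbolic_carrier n" "y \<in> hyperbolic_carrier n" and j: "j \<in> {1..m}"
    have "\<bar>G x j - G y j\<bar> \<le> DG x y"
      unfolding DG_def by (rule member_le_L2_set) (use j in auto)
    also have "\<dots> \<le> sqrt ((DF x y)\<^sup>2 + (DG x y)\<^sup>2)"
      by (rule real_sqrt_sum_squares_ge2)
    finally show "\<bar>G x j - G y j\<bar> \<le> L * hyperbolic_dist n x y + l"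
      using qi[OF xy] unfolding prod by linarith
  next
    fix x y assume xy: "x \<in> hyperbolic_carrier n" "y \<in> hyperbolic_carrier n"
    have "sqrt ((DF x y)\<^sup>2 + (DG x y)\<^sup>2) \<le> DF x y + DG x y"
      using nonneg by (rule sqrt_sum_squares_le_sum)
    also have "DF x y \<le> (\<Sum>i=1..n - 1. mdist (T i) (F x i) (F y i))"
      unfolding DF_def by (rule L2_set_le_sum) simp
    also have "DG x y \<le> (\<Sum>j=1..m. \<bar>G x j - G y j\<bar>)"
      unfolding DG_def by (rule L2_set_le_sum) simp
    finally show "hyperbolic_dist n x y / L - l \<le>
        (\<Sum>i=1..n - 1. mdist (T i) (F x i) (F y i)) + (\<Sum>j=1..m. \<bar>G x j - G y j\<bar>)"
      using qi[OF xy] unfolding prod by simp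
  qed
qed

end
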